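(* Let $\Phi$ be a formula of MLSSPF with set of variables $\mathcal X_\Phi$, and let $\mathcal M$ be a finite set-valued assignment to $\mathcal X_\Phi$ (every $\mathcal M(x)$ is finite) which is transitive (its Venn partition $\Sigma_{\mathcal X_\Phi}$ is a transitive partition) and which satisfies every literal of $\Phi$ except possibly those of the form $\neg\mathit{Finite}(x)$. Let $\mathcal G=(T,\mathcal F,\mathcal Q)$ be the canonical colored $\Sigma_{\mathcal X_\Phi}$-board of $\mathcal M$ and $\Phi$, and let $\big((\{q^{(\mu)}\}_{q\in\mathcal P})_{\mu\le\ell},(\bullet),T,\mathcal F,\mathcal Q\big)$ be an associated colored $\mathcal P$-process, with final partition $\Sigma_\ell=\Sigma_{\mathcal X_\Phi}$ and with $\ell$ finite. Suppose there is a simple pumping event $\langle q_0,i_0,\mathcal C\rangle$ relative to this process such that: (1) the set $(\mathcal C)_{\mathrm{places}}$ of places occurring in $\mathcal C$ is contained in a closed set of places; and (2) for each variable $x$ such that the literal $\neg\mathit{Finite}(x)$ occurs in $\Phi$, the set $\Im_{\mathcal M}(x)\cap(\mathcal C)_{\mathrm{places}}$ is not empty (places being identified with blocks via $q\mapsto q^{(\bullet)}$). Then there exists a model for $\Phi$, i.e. a set-valued assignment to $\mathcal X_\Phi$ satisfying all literals of $\Phi$.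
   Context: **Language.** An MLSSPF formula is a finite conjunction (collection) of literals of the forms $v=w$, $v\ne w$, $v=\emptyset$, $v=u\cup w$, $v=u\cap w$, $v=u\setminus w$, $v\subseteq u$, $v\not\subseteq u$, $v\in w$, $v\notin w$, $v=\wp(w)$ (powerset), $v=\{w_0,\dots,w_H\}$, $\mathit{Finite}(v)$ and $\neg\mathit{Finite}(v)$, where $u,v,w,w_i$ are variables. An assignment maps each variable to a set; literals are interpreted in the obvious way, $\mathit{Finite}(v)$ meaning that the set assigned to $v$ has cardinality $<\aleph_0$. A model of $\Phi$ is an assignment satisfying all literals of $\Phi$. **Partitions.** A partition is a family $\Sigma$ of nonempty pairwise disjoint sets (its blocks). It is transitive if $\bigcup\Sigma$ is a transitive set. The Venn partition of a family $\mathcal H$ is the coarsest partition $\Sigma$ of $\bigcup\mathcal H$ such that for all $x\in\mathcal H$ and $p\in\Sigma$, $p\cap x\neq\emptyset$ implies $p\subseteq x$. For an assignment $\mathcal M$, $\Sigma_{\mathcal X_\Phi}$ is the Venn partition of $\{\mathcal M(v):v\in\mathcal X_\Phi\}$, and $\Im_{\mathcal M}(v)\subseteq\Sigma_{\mathcal X_\Phi}$ is the set of blocks with $\mathcal M(v)=\bigcup\Im_{\mathcal M}(v)$. For a set $X$, $\wp^*(X)=\{Y : Y\subseteq\bigcup X \text{ and } Y\cap z\ne\emptyset\text{ for all }z\in X\}$. **Boards.** Let $\mathcal P$ be a finite set, whose elements are called places and whose subsets are called nodes. A colored $\mathcal P$-board $(T,\mathcal F,\mathcal Q)$ consists of a target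 function $T:\wp(\mathcal P)\to\wp(\mathcal P)$, a set $\mathcal F\subseteq\mathcal P$ of red places (the other places are green), and a set $\mathcal Q\subseteq\wp(\mathcal P)$ of nodes, called $\wp$-nodes, closed under taking subsets. It is viewed as a directed bipartite graph with edges $q\to B$ for $q\in B\subseteq\mathcal P$, and $A\to t$ for $t\in T(A)$. Given a transitive partition $\Sigma$ and a bijection $q\mapsto q^{(\bullet)}$ from $\mathcal P$ to $\Sigma$, write $A^{(\bullet)}=\{q^{(\bullet)}:q\in A\}$. The induced target function is $T(A)=\{q:\wp^*(A^{(\bullet)})\cap q^{(\bullet)}\neq\emptyset\}$. The canonical board of $\mathcal M$ and $\Phi$ is the board on $\Sigma_{\mathcal X_\Phi}$ (places identified with blocks) with this $T$; with $\mathcal F$ the union of all $\Im_{\mathcal M}(v)$ for which a literal $v=\{w_0,\dots,w_H\}$ or $\mathit{Finite}(v)$ occurs in $\Phi$; and with $\mathcal Q$ the smallest collection of nodes closed under subsets and containing $\Im_{\mathcal M}(w)$ for each literal $u=\wp(w)$ in $\Phi$. **Formative processes.** Let $\xi$ be an ordinal and, for each $\mu\le\xi$, let $q\mapsto q^{(\mu)}$ be a function on $\mathcal P$. Put $B^{(\mu)}=\{q^{(\mu)}:q\in B\}$ and $\Sigma_\mu=\mathcal P^{(\mu)}\setminus\{\emptyset\}$. This sequence is a formative process for $\Sigma_\xi$ if: - $q^{(\mu)}\cap p^{(\mu)}=\emptyset$ for $p\ne q$; - $q^{(\nu)}\subseteq q^{(\nu+1)}$ for $\nu<\xi$; - $q^{(\lambda)}=\bigcup_{\nu<\lambda}q^{(\nu)}$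 for limit $\lambda\le\xi$; - $q^{(0)}=\emptyset\ne q^{(\xi)}$; - for each $\nu<\xi$ there is $\Gamma_\nu\subseteq\Sigma_\nu$ such that (a) for every $\sigma\in\Sigma_\nu$ there is exactly one $\sigma'\in\Sigma_{\nu+1}$ with $\sigma\subseteq\sigma'$, $\bigcup\Sigma_{\nu+1}\setminus\bigcup\Sigma_\nu\subseteq\wp^*(\Gamma_\nu)$, and $\Sigma_\nu\neq\Sigma_{\nu+1}$; and (b) no element of $\bigcup\Sigma_\xi$ belongs to $\wp^*(\Gamma_\nu)\setminus\bigcup\Sigma_{\nu+1}$. One writes $q^{(\bullet)}=q^{(\xi)}$ and $A^{(\bullet)}=A^{(\xi)}$. A colored $\mathcal P$-process is a formative process together with a colored $\mathcal P$-board $(T,\mathcal F,\mathcal Q)$ whose target function is the one induced by $\Sigma_\xi$ via $q\mapsto q^{(\bullet)}$; it is associated with the canonical board if that is the board in question (with $\Sigma_\xi=\Sigma_{\mathcal X_\Phi}$). **Grand events, local trash, closed sets.** For a node $A$, $GE(A)$ is the ordinal $\nu<\xi$ with $\bigcup A^{(\bullet)}\in\bigcup\mathcal P^{(\nu+1)}\setminus\bigcup\mathcal P^{(\nu)}$ if one exists, and $GE(A)=\xi$ otherwise. For a collection $\mathcal A$ of nodes, $GE(\mathcal A)=\min\{GE(A):A\in\mathcal A\}$. A place $g$ is a local trash for a node $A$ if $g\in T(A)\setminus\mathcal F$ and $GE(A)<GE(B)$ for every node $B$ with $g\in B$. A set $\mathcal W$ of places is closed if all its elements are green and every $\wp$-node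 intersecting $\mathcal W$ has a local trash belonging to $\mathcal W$. **Pumping.** A path in a board is a list of vertices alternating between places and nodes in which consecutive vertices form edges. It is simple if no place and no node occurs twice. A simple pumping cycle is a path $\mathcal C=C_0,q_0,C_1,\dots,q_n,C_{n+1}$ with $n\ge0$, $C_i$ nodes and $q_i$ places, such that $C_0,q_0,C_1,\dots,q_n$ is simple, $C_{n+1}=C_0$, and no $q_i$ is red. Write $(\mathcal C)_{\mathrm{places}}$ and $(\mathcal C)_{\mathrm{nodes}}$ for the sets of its places and nodes, and $\mathcal N(B)$ for the collection of all nodes having nonempty intersection with $B$. For a colored $\mathcal P$-process of finite length $\ell$, $\langle q_0,i_0,\mathcal C\rangle$ (with $i_0\le\ell$) is a simple pumping event if $\mathcal C$ is a simple pumping cycle and - (i) $q_0\in(\mathcal C)_{\mathrm{places}}$ and $q_0^{(i_0)}\setminus\bigcup\bigcup\mathcal P^{(i_0)}\neq\emptyset$; - (ii) $GE(\mathcal N((\mathcal C)_{\mathrm{places}}))\ge i_0$; - (iii) $\emptyset\notin B^{(i_0)}$ (equivalently $\wp^*(B^{(i_0)})\ne\emptyset$) for every $B\in(\mathcal C)_{\mathrm{nodes}}$. *)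

theory Defs
  imports Main "HOL-Library.Disjoint_Sets"
begin

section \<open>The universe of sets\<close>

text \<open>
  The universe in which variables take their values: a model of ZFC, given by its elementhood
  function. The axioms are extensionality, separation, union, powerset, replacement, infinity and
  foundation, where separation and replacement range over arbitrary HOL sets and functions.
  Infinity, stated for the range of any sequence, subsumes pairing (take a range \<open>{x, y}\<close>); choice is
  inherited from HOL's choice operator. The sets of the universe are exactly the ``small'' HOL sets
  \<open>elts x\<close>; in what follows partitions, blocks and the sets \<open>q\<^sup>(\<^sup>\<mu>\<^sup>)\<close> are HOL sets of elements of the
  universe. All of them that matter are subsets of some \<open>elts x\<close>, hence are sets of the universe.
\<close>

class zfc_universe =
  fixes elts :: "'a \<Rightarrow> 'a set"
  assumes zfc_ext: "elts x = elts y \<Longrightarrow> x = y"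
    and zfc_separation: "Y \<subseteq> elts x \<Longrightarrow> \<exists>y. elts y = Y"
    and zfc_union: "\<exists>y. elts y = \<Union>(elts ` elts x)"
    and zfc_powerset: "\<exists>y. elts y = {z. elts z \<subseteq> elts x}"
    and zfc_replacement: "\<exists>y. elts y = f ` elts x"
    and zfc_infinity: "\<exists>y. elts y = range (g :: nat \<Rightarrow> 'a)"
    and zfc_foundation: "wf {(x, y). x \<in> elts y}"


section \<open>The language MLSSPF\<close>

text \<open>\<open>Enum v w ws\<close> is the literal \<open>v = {w\<^sub>0, \<dots>, w\<^sub>H}\<close>, with \<open>w\<close> for \<open>w\<^sub>0\<close> and \<open>ws\<close> for the rest.\<close>

datatype (lit_vars: 'x) literal =
    Equal 'x 'x
  | NotEqual 'x 'x
  | Empty 'x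
  | Union 'x 'x 'x
  | Inter 'x 'x 'x
  | Diff 'x 'x 'x
  | Subset 'x 'x
  | NotSubset 'x 'x
  | Member 'x 'x
  | NotMember 'x 'x
  | Powerset 'x 'x
  | Enum 'x 'x "'x list"
  | Finite 'x
  | NotFinite 'x

primrec satisfies :: "('x \<Rightarrow> 'v::zfc_universe) \<Rightarrow> 'x literal \<Rightarrow> bool" where
  "satisfies M (Equal v w) \<longleftrightarrow> M v = M w"
| "satisfies M (NotEqual v w) \<longleftrightarrow> M v \<noteq> M w"
| "satisfies M (Empty v) \<longleftrightarrow> elts (M v) = {}"
| "satisfies M (Union v u w) \<longleftrightarrow> elts (M v) = elts (M u) \<union> elts (M w)"
| "satisfies M (Inter v u w) \<longleftrightarrow> elts (M v) = elts (M u) \<inter> elts (M w)"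
| "satisfies M (Diff v u w) \<longleftrightarrow> elts (M v) = elts (M u) - elts (M w)"
| "satisfies M (Subset v u) \<longleftrightarrow> elts (M v) \<subseteq> elts (M u)"
| "satisfies M (NotSubset v u) \<longleftrightarrow> \<not> elts (M v) \<subseteq> elts (M u)"
| "satisfies M (Member v w) \<longleftrightarrow> M v \<in> elts (M w)"
| "satisfies M (NotMember v w) \<longleftrightarrow> M v \<notin> elts (M w)"
| "satisfies M (Powerset v w) \<longleftrightarrow> elts (M v) = {x. elts x \<subseteq> elts (M w)}"
| "satisfies M (Enum v w ws) \<longleftrightarrow> elts (M v) = M ` set (w # ws)"
| "satisfies M (Finite v) \<longleftrightarrow> finite (elts (M v))"
| "satisfies M (NotFinite v) \<longleftrightarrow> \<not> finite (elts (M v))"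

definition formula_vars :: "'x literal set \<Rightarrow> 'x set" where
  "formula_vars \<Phi> = (\<Union>l\<in>\<Phi>. lit_vars l)"

definition is_model :: "('x \<Rightarrow> 'v::zfc_universe) \<Rightarrow> 'x literal set \<Rightarrow> bool" where
  "is_model M \<Phi> \<longleftrightarrow> (\<forall>l\<in>\<Phi>. satisfies M l)"


section \<open>Partitions\<close>

definition transitive_partition :: "'v::zfc_universe set set \<Rightarrow> bool" where
  "transitive_partition \<Sigma> \<longleftrightarrow>
     partition_on (\<Union>\<Sigma>) \<Sigma> \<and> (\<forall>x\<in>\<Union>\<Sigma>. elts x \<subseteq> \<Union>\<Sigma>)"

definition compatible_partition :: "'a set set \<Rightarrow> 'a set set \<Rightarrow> bool" where
  "compatible_partition H \<Sigma> \<longleftrightarrow>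
     partition_on (\<Union>H) \<Sigma> \<and> (\<forall>x\<in>H. \<forall>p\<in>\<Sigma>. p \<inter> x \<noteq> {} \<longrightarrow> p \<subseteq> x)"

definition is_venn_partition :: "'a set set \<Rightarrow> 'a set set \<Rightarrow> bool" where
  "is_venn_partition H \<Sigma> \<longleftrightarrow>
     compatible_partition H \<Sigma> \<and>
     (\<forall>\<Sigma>'. compatible_partition H \<Sigma>' \<longrightarrow> refines (\<Union>H) \<Sigma>' \<Sigma>)"

definition venn_partition :: "'a set set \<Rightarrow> 'a set set" where
  "venn_partition H = (THE \<Sigma>. is_venn_partition H \<Sigma>)"

definition model_partition :: "('x \<Rightarrow> 'v::zfc_universe) \<Rightarrow> 'x literal set \<Rightarrow> 'v set set" where
  "model_partition M \<Phi> = venn_partition ((\<lambda>v. elts (M v)) ` formula_vars \<Phi>)"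

definition var_blocks :: "('x \<Rightarrow> 'v::zfc_universe) \<Rightarrow> 'x literal set \<Rightarrow> 'x \<Rightarrow> 'v set set" where
  "var_blocks M \<Phi> v = (THE I. I \<subseteq> model_partition M \<Phi> \<and> elts (M v) = \<Union>I)"

definition pow_star :: "'v::zfc_universe set set \<Rightarrow> 'v set" where
  "pow_star X = {y. elts y \<subseteq> \<Union>X \<and> (\<forall>z\<in>X. elts y \<inter> z \<noteq> {})}"

text \<open>The two definite descriptions above are well defined.\<close>

lemma is_venn_partition_exists: "\<exists>\<Sigma>. is_venn_partition H \<Sigma>"
proof -
  define r where "r = {(a, b). a \<in> \<Union>H \<and> b \<in> \<Union>H \<and> (\<forall>x\<in>H. a \<in> x \<longleftrightarrow> b \<in> x)}"
  have r: "equiv (\<Union>H) r"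
    by (rule equivI) (auto simp: r_def refl_on_def sym_def trans_def)
  have part: "partition_on (\<Union>H) (\<Union>H // r)"
    using r by (rule partition_on_quotient)
  have comp: "compatible_partition H (\<Union>H // r)"
    unfolding compatible_partition_def
  proof (intro conjI part ballI impI)
    fix x p assume "x \<in> H" "p \<in> \<Union>H // r" "p \<inter> x \<noteq> {}"
    then show "p \<subseteq> x" by (auto simp: r_def elim!: quotientE)
  qed
  have "refines (\<Union>H) \<Sigma>' (\<Union>H // r)" if S: "compatible_partition H \<Sigma>'" for \<Sigma>'
    unfolding refines_def
  proof (intro conjI ballI part)
    show P: "partition_on (\<Union>H) \<Sigma>'" using S by (simp add: compatible_partition_def)
    fix X assume X: "X \<in> \<Sigma>'"
    then have "X \<noteq> {}" using P by (auto simp: partition_on_def)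
    then obtain a where a: "a \<in> X" by blast
    then have aH: "a \<in> \<Union>H" using P X by (auto simp: partition_on_def)
    have "X \<subseteq> r `` {a}"
    proof
      fix b assume b: "b \<in> X"
      then have "b \<in> \<Union>H" using P X by (auto simp: partition_on_def)
      moreover have "a \<in> x \<longleftrightarrow> b \<in> x" if "x \<in> H" for x
        using S X a b that unfolding compatible_partition_def by blast
      ultimately show "b \<in> r `` {a}" using aH by (auto simp: r_def)
    qed
    then show "\<exists>Y\<in>\<Union>H // r. X \<subseteq> Y" using quotientI[OF aH, of r] by blast
  qed
  with comp show ?thesis unfolding is_venn_partition_def by blast
qed

lemma is_venn_partition_venn_partition: "is_venn_partition H (venn_partition H)"
proof -
  have "\<exists>!\<Sigma>. is_venn_partition H \<Sigma>"
    using is_venn_partition_exists[of H]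
    by (metis is_venn_partition_def refines_asym)
  then show ?thesis unfolding venn_partition_def by (rule theI')
qed

lemma var_blocks_eq:
  assumes "v \<in> formula_vars \<Phi>"
  shows "var_blocks M \<Phi> v = {p \<in> model_partition M \<Phi>. p \<subseteq> elts (M v)}"
    and "elts (M v) = \<Union>(var_blocks M \<Phi> v)"
proof -
  let ?H = "(\<lambda>v. elts (M v)) ` formula_vars \<Phi>"
  let ?S = "model_partition M \<Phi>"
  have comp: "compatible_partition ?H ?S"
    using is_venn_partition_venn_partition[of ?H]
    by (simp add: is_venn_partition_def model_partition_def)
  have vH: "elts (M v) \<in> ?H" using assms by blast
  have P: "\<Union>?S = \<Union>?H" "disjoint ?S" "{} \<notin> ?S"
    using comp by (auto simp: compatible_partition_def partition_on_def)
  have C: "p \<subseteq> elts (M v)" if "p \<in> ?S" "p \<inter> elts (M v) \<noteq> {}" for p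
    using comp vH that unfolding compatible_partition_def by blast
  have U: "elts (M v) = \<Union>{p \<in> ?S. p \<subseteq> elts (M v)}"
  proof
    show "elts (M v) \<subseteq> \<Union>{p \<in> ?S. p \<subseteq> elts (M v)}"
    proof
      fix a assume a: "a \<in> elts (M v)"
      then have "a \<in> \<Union>?S" using vH P(1) by blast
      then obtain p where "p \<in> ?S" "a \<in> p" by blast
      then show "a \<in> \<Union>{p \<in> ?S. p \<subseteq> elts (M v)}" using C[of p] a by blast
    qed
  qed blast
  have uniq: "I = {p \<in> ?S. p \<subseteq> elts (M v)}" if I: "I \<subseteq> ?S" "elts (M v) = \<Union>I" for I
  proof
    show "I \<subseteq> {p \<in> ?S. p \<subseteq> elts (M v)}" using I by blast
    show "{p \<in> ?S. p \<subseteq> elts (M v)} \<subseteq> I"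
    proof
      fix p assume p: "p \<in> {p \<in> ?S. p \<subseteq> elts (M v)}"
      then obtain a where a: "a \<in> p" using P(3) by (metis (no_types, lifting) ex_in_conv mem_Collect_eq)
      then obtain q where q: "q \<in> I" "a \<in> q" using p I(2) by blast
      then have "q = p" using P(2) p a I(1) unfolding disjoint_def by blast
      then show "p \<in> I" using q by simp
    qed
  qed
  show "var_blocks M \<Phi> v = {p \<in> ?S. p \<subseteq> elts (M v)}"
    unfolding var_blocks_def by (rule the_equality) (use U uniq in auto)
  then show "elts (M v) = \<Union>(var_blocks M \<Phi> v)" using U by simp
qed


section \<open>Colored boards\<close>

text \<open>Places are the elements of a set \<open>P\<close>, nodes are the subsets of \<open>P\<close>.\<close>

record 'p board =
  target :: "'p set \<Rightarrow> 'p set"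
  red :: "'p set"
  pow_nodes :: "'p set set"

definition colored_board :: "'p set \<Rightarrow> 'p board \<Rightarrow> bool" where
  "colored_board P G \<longleftrightarrow>
     finite P \<and>
     (\<forall>A\<subseteq>P. target G A \<subseteq> P) \<and>
     red G \<subseteq> P \<and>
     pow_nodes G \<subseteq> Pow P \<and>
     (\<forall>A\<in>pow_nodes G. \<forall>B\<subseteq>A. B \<in> pow_nodes G)"

text \<open>\<open>b\<close> is the map \<open>q \<mapsto> q\<^sup>(\<^sup>\<bullet>\<^sup>)\<close>.\<close>

definition induced_target :: "'p set \<Rightarrow> ('p \<Rightarrow> 'v::zfc_universe set) \<Rightarrow> 'p set \<Rightarrow> 'p set" where
  "induced_target P b A = {q \<in> P. pow_star (b ` A) \<inter> b q \<noteq> {}}"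

text \<open>The places of the canonical board are the blocks themselves.\<close>

definition canonical_board ::
  "('x \<Rightarrow> 'v::zfc_universe) \<Rightarrow> 'x literal set \<Rightarrow> 'v set board" where
  "canonical_board M \<Phi> =
     \<lparr>target = induced_target (model_partition M \<Phi>) (\<lambda>p. p),
      red = \<Union>{var_blocks M \<Phi> v | v. (\<exists>w ws. Enum v w ws \<in> \<Phi>) \<or> Finite v \<in> \<Phi>},
      pow_nodes = \<Inter>{Q. (\<forall>A\<in>Q. \<forall>B\<subseteq>A. B \<in> Q) \<and>
                        (\<forall>u w. Powerset u w \<in> \<Phi> \<longrightarrow> var_blocks M \<Phi> w \<in> Q)}\<rparr>"

text \<open>
  The board \<open>G\<close> on \<open>P\<close> becomes the board \<open>H\<close> on \<open>P'\<close> when places are identified via \<open>b\<close>.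
  Values of the target functions outside the nodes are irrelevant.
\<close>

definition board_identified ::
  "('p \<Rightarrow> 'q) \<Rightarrow> 'p set \<Rightarrow> 'p board \<Rightarrow> 'q set \<Rightarrow> 'q board \<Rightarrow> bool" where
  "board_identified b P G P' H \<longleftrightarrow>
     bij_betw b P P' \<and>
     (\<forall>A\<subseteq>P. b ` target G A = target H (b ` A)) \<and>
     b ` red G = red H \<and>
     (\<lambda>A. b ` A) ` pow_nodes G = pow_nodes H"


section \<open>Formative processes of finite length\<close>

text \<open>
  \<open>s \<mu> q\<close> is \<open>q\<^sup>(\<^sup>\<mu>\<^sup>)\<close>, for \<open>\<mu> \<le> \<xi>\<close>. Only processes whose length \<open>\<xi>\<close> is a natural number are
  considered, so the clause on limit ordinals is void.
\<close>

definition stage_partition ::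
  "'p set \<Rightarrow> (nat \<Rightarrow> 'p \<Rightarrow> 'v set) \<Rightarrow> nat \<Rightarrow> 'v set set" where
  "stage_partition P s \<mu> = s \<mu> ` P - {{}}"

definition formative_process ::
  "'p set \<Rightarrow> nat \<Rightarrow> (nat \<Rightarrow> 'p \<Rightarrow> 'v::zfc_universe set) \<Rightarrow> bool" where
  "formative_process P \<xi> s \<longleftrightarrow>
     (\<forall>\<mu>\<le>\<xi>. \<forall>p\<in>P. \<forall>q\<in>P. p \<noteq> q \<longrightarrow> s \<mu> q \<inter> s \<mu> p = {}) \<and>
     (\<forall>\<nu><\<xi>. \<forall>q\<in>P. s \<nu> q \<subseteq> s (Suc \<nu>) q) \<and>
     (\<forall>q\<in>P. s 0 q = {} \<and> s \<xi> q \<noteq> {}) \<and>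
     (\<forall>\<nu><\<xi>. \<exists>\<Gamma>\<subseteq>stage_partition P s \<nu>.
        (\<forall>\<sigma>\<in>stage_partition P s \<nu>. \<exists>!\<sigma>'. \<sigma>' \<in> stage_partition P s (Suc \<nu>) \<and> \<sigma> \<subseteq> \<sigma>') \<and>
        \<Union>(stage_partition P s (Suc \<nu>)) - \<Union>(stage_partition P s \<nu>) \<subseteq> pow_star \<Gamma> \<and>
        stage_partition P s \<nu> \<noteq> stage_partition P s (Suc \<nu>) \<and>
        \<Union>(stage_partition P s \<xi>) \<inter> (pow_star \<Gamma> - \<Union>(stage_partition P s (Suc \<nu>))) = {})"

definition colored_process ::
  "'p set \<Rightarrow> nat \<Rightarrow> (nat \<Rightarrow> 'p \<Rightarrow> 'v::zfc_universe set) \<Rightarrow> 'p board \<Rightarrow> bool" where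
  "colored_process P \<xi> s G \<longleftrightarrow>
     formative_process P \<xi> s \<and>
     transitive_partition (stage_partition P s \<xi>) \<and>
     colored_board P G \<and>
     (\<forall>A\<subseteq>P. target G A = induced_target P (s \<xi>) A)"

definition associated_with_canonical ::
  "('x \<Rightarrow> 'v::zfc_universe) \<Rightarrow> 'x literal set \<Rightarrow>
   'p set \<Rightarrow> nat \<Rightarrow> (nat \<Rightarrow> 'p \<Rightarrow> 'v set) \<Rightarrow> 'p board \<Rightarrow> bool" where
  "associated_with_canonical M \<Phi> P \<xi> s G \<longleftrightarrow>
     stage_partition P s \<xi> = model_partition M \<Phi> \<and>
     board_identified (s \<xi>) P G (model_partition M \<Phi>) (canonical_board M \<Phi>)"


section \<open>Grand events, local trashes and closed sets\<close>

text \<open>\<open>\<Union>A\<^sup>(\<^sup>\<bullet>\<^sup>)\<close>, as an element of the universe, is the \<open>y\<close> with \<open>elts y = \<Union>(s \<xi> ` A)\<close>.\<close>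

definition grand_event_at ::
  "'p set \<Rightarrow> nat \<Rightarrow> (nat \<Rightarrow> 'p \<Rightarrow> 'v::zfc_universe set) \<Rightarrow> 'p set \<Rightarrow> nat \<Rightarrow> bool" where
  "grand_event_at P \<xi> s A \<nu> \<longleftrightarrow>
     \<nu> < \<xi> \<and> (\<exists>y \<in> \<Union>(s (Suc \<nu>) ` P) - \<Union>(s \<nu> ` P). elts y = \<Union>(s \<xi> ` A))"

definition GE :: "'p set \<Rightarrow> nat \<Rightarrow> (nat \<Rightarrow> 'p \<Rightarrow> 'v::zfc_universe set) \<Rightarrow> 'p set \<Rightarrow> nat" where
  "GE P \<xi> s A =
     (if \<exists>\<nu>. grand_event_at P \<xi> s A \<nu> then THE \<nu>. grand_event_at P \<xi> s A \<nu> else \<xi>)"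

definition GE_coll ::
  "'p set \<Rightarrow> nat \<Rightarrow> (nat \<Rightarrow> 'p \<Rightarrow> 'v::zfc_universe set) \<Rightarrow> 'p set set \<Rightarrow> nat" where
  "GE_coll P \<xi> s \<A> = Min (GE P \<xi> s ` \<A>)"

definition local_trash ::
  "'p set \<Rightarrow> nat \<Rightarrow> (nat \<Rightarrow> 'p \<Rightarrow> 'v::zfc_universe set) \<Rightarrow> 'p board \<Rightarrow> 'p \<Rightarrow> 'p set \<Rightarrow> bool" where
  "local_trash P \<xi> s G g A \<longleftrightarrow>
     g \<in> target G A - red G \<and> (\<forall>B\<subseteq>P. g \<in> B \<longrightarrow> GE P \<xi> s A < GE P \<xi> s B)"

definition closed_places ::
  "'p set \<Rightarrow> nat \<Rightarrow> (nat \<Rightarrow> 'p \<Rightarrow> 'v::zfc_universe set) \<Rightarrow> 'p board \<Rightarrow> 'p set \<Rightarrow> bool" where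
  "closed_places P \<xi> s G W \<longleftrightarrow>
     W \<subseteq> P - red G \<and>
     (\<forall>A\<in>pow_nodes G. A \<inter> W \<noteq> {} \<longrightarrow> (\<exists>g\<in>W. local_trash P \<xi> s G g A))"


section \<open>Pumping\<close>

datatype 'p vertex = Place 'p | Node "'p set"

inductive board_edge :: "'p set \<Rightarrow> 'p board \<Rightarrow> 'p vertex \<Rightarrow> 'p vertex \<Rightarrow> bool"
  for P G where
  "q \<in> B \<Longrightarrow> B \<subseteq> P \<Longrightarrow> board_edge P G (Place q) (Node B)"
| "A \<subseteq> P \<Longrightarrow> t \<in> target G A \<Longrightarrow> board_edge P G (Node A) (Place t)"

definition board_path :: "'p set \<Rightarrow> 'p board \<Rightarrow> 'p vertex list \<Rightarrow> bool" where
  "board_path P G vs \<longleftrightarrow>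
     set vs \<subseteq> Place ` P \<union> Node ` Pow P \<and> successively (board_edge P G) vs"

definition simple_path :: "'p set \<Rightarrow> 'p board \<Rightarrow> 'p vertex list \<Rightarrow> bool" where
  "simple_path P G vs \<longleftrightarrow> board_path P G vs \<and> distinct vs"

definition path_places :: "'p vertex list \<Rightarrow> 'p set" where
  "path_places vs = {q. Place q \<in> set vs}"

definition path_nodes :: "'p vertex list \<Rightarrow> 'p set set" where
  "path_nodes vs = {B. Node B \<in> set vs}"

text \<open>
  In \<open>Node C\<^sub>0 # vs @ [Node C\<^sub>0]\<close> the nonempty list \<open>vs\<close> is \<open>q\<^sub>0, C\<^sub>1, \<dots>, q\<^sub>n\<close>: it starts and
  ends with a place because edges only join places and nodes.
\<close>

definition simple_pumping_cycle :: "'p set \<Rightarrow> 'p board \<Rightarrow> 'p vertex list \<Rightarrow> bool" where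
  "simple_pumping_cycle P G \<C> \<longleftrightarrow>
     board_path P G \<C> \<and>
     (\<exists>C\<^sub>0 vs. \<C> = Node C\<^sub>0 # vs @ [Node C\<^sub>0] \<and> vs \<noteq> [] \<and> simple_path P G (Node C\<^sub>0 # vs)) \<and>
     path_places \<C> \<inter> red G = {}"

definition nodes_meeting :: "'p set \<Rightarrow> 'p set \<Rightarrow> 'p set set" where
  "nodes_meeting P B = {A. A \<subseteq> P \<and> A \<inter> B \<noteq> {}}"

definition simple_pumping_event ::
  "'p set \<Rightarrow> nat \<Rightarrow> (nat \<Rightarrow> 'p \<Rightarrow> 'v::zfc_universe set) \<Rightarrow> 'p board \<Rightarrow>
   'p \<Rightarrow> nat \<Rightarrow> 'p vertex list \<Rightarrow> bool" where
  "simple_pumping_event P L s G q\<^sub>0 i\<^sub>0 \<C> \<longleftrightarrow>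
     i\<^sub>0 \<le> L \<and>
     simple_pumping_cycle P G \<C> \<and>
     q\<^sub>0 \<in> path_places \<C> \<and>
     s i\<^sub>0 q\<^sub>0 - \<Union>(elts ` \<Union>(s i\<^sub>0 ` P)) \<noteq> {} \<and>
     i\<^sub>0 \<le> GE_coll P L s (nodes_meeting P (path_places \<C>)) \<and>
     (\<forall>B\<in>path_nodes \<C>. {} \<notin> s i\<^sub>0 ` B)"

end

theory Submission
  imports Defs "HOL-Library.Infinite_Set"
begin

text \<open>
  The given assignment is finite, so it misses only the literals \<open>\<not>Finite(x)\<close>. The proof enlarges its
  partition: every block \<open>q\<^sup>(\<^sup>\<bullet>\<^sup>)\<close> is replaced by a set \<open>hat q\<close> which is infinite when \<open>q\<close> lies on the
  pumping cycle, and every variable is mapped to the union of the new blocks that correspond to its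
  old blocks. The other literals survive if the new blocks imitate the old ones closely enough:
  they are nonempty and disjoint (Boolean literals), the union of the blocks of a node \<open>A\<close> belongs to
  \<open>hat q\<close> exactly if the old union belonged to \<open>q\<^sup>(\<^sup>\<bullet>\<^sup>)\<close> (membership and enumerations), an element of
  \<open>hat q\<close> in \<open>pow_star\<close> of the new blocks of \<open>A\<close> forces \<open>q\<close> to be a target of \<open>A\<close>, and for a \<open>\<wp>\<close>-node
  all of this \<open>pow_star\<close> is covered by new blocks (powersets).

  The new block is \<open>hat q = \<phi> ` q\<^sup>(\<^sup>\<bullet>\<^sup>) \<union> surplus q\<close>, where \<open>\<phi>\<close> copies the old universe. The surplus has
  two sources. Walking round the cycle forever, starting from the element \<open>z\<close> that belongs to no
  element present at stage \<open>i\<^sub>0\<close>, produces an infinite \<open>\<in>\<close>-chain: the next element consists of the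
  current one and of old representatives of the places of the next node. These
  elements are distributed over the places of the cycle. They then create new subsets of blocks at
  the \<open>\<wp>\<close>-nodes that meet the closed set; each such node sends its new subsets to its local trash.
  Every surplus element thus lies in a green place, so red blocks are merely copied and remain finite.

  The copy \<open>\<phi> x\<close> is \<open>x\<close> itself if \<open>x\<close> enters the process before stage \<open>i\<^sub>0\<close>. The union of the old
  blocks of a node is sent to the union of its new blocks. Any other \<open>x\<close> is sent to \<open>\<phi> ` x\<close>, with two
  chain elements added if \<open>x\<close> meets a place of the cycle: the chain may run into elements that enter
  the process later on and belong to another place, and this addition moves those out of its way.

  The definition of \<open>\<phi>\<close> and of the surplus is circular only in appearance. The union of the new blocks
  of \<open>A\<close> depends on the trash of nodes whose local trash lies in \<open>A\<close>, and these have an earlier grand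
  event; so a recursion along the stages of the process defines everything (\<open>\<phi>_fixed_point\<close>,
  \<open>trash_of_eq\<close>, \<open>surplus_eq\<close>). That no two new elements collide is proved by one induction along
  \<open>\<in>\<close> (\<open>separated_step\<close>): once the elements of a set are known to determine their places, the set
  determines its node and its old preimage. The literals are then transferred in
  \<open>satisfies_pumped\<close>.
\<close>

section \<open>Sets of the universe\<close>

definition small :: "'v::zfc_universe set \<Rightarrow> bool" where
  "small Y \<longleftrightarrow> (\<exists>x. elts x = Y)"

definition to_set :: "'v::zfc_universe set \<Rightarrow> 'v" where
  "to_set Y = (SOME x. elts x = Y)"

lemma elts_to_set: "small Y \<Longrightarrow> elts (to_set Y) = Y"
  unfolding small_def to_set_def by (rule someI_ex)

lemma small_elts: "small (elts x)"
  unfolding small_def by (rule exI) (rule refl)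

lemma to_set_elts: "to_set (elts x) = x"
  by (rule zfc_ext, rule elts_to_set, rule small_elts)

lemma small_subset:
  assumes "small Y" "X \<subseteq> Y"
  shows "small X"
proof -
  obtain y where "elts y = Y" using assms(1) unfolding small_def ..
  then have "X \<subseteq> elts y" using assms(2) by simp
  then show ?thesis unfolding small_def by (rule zfc_separation)
qed

lemma small_image:
  fixes f :: "'v \<Rightarrow> 'v::zfc_universe"
  assumes "small Y"
  shows "small (f ` Y)"
proof -
  obtain y where "elts y = Y" using assms unfolding small_def ..
  then show ?thesis unfolding small_def using zfc_replacement[of f y] by simp
qed

lemma small_range: "small (range (f :: nat \<Rightarrow> _))"
  unfolding small_def by (rule zfc_infinity)

lemma small_Un:
  assumes "small X" "small Y"
  shows "small (X \<union> Y)"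
proof -
  obtain x y where xy: "elts x = X" "elts y = Y"
    using assms unfolding small_def by blast
  have "range (\<lambda>n::nat. if n = 0 then x else y) = {x, y}"
    by (auto simp: image_def)
  then obtain p where "elts p = {x, y}"
    using zfc_infinity[of "\<lambda>n. if n = 0 then x else y"] by metis
  then have "\<Union> (elts ` elts p) = X \<union> Y" using xy by simp
  then show ?thesis
    unfolding small_def using zfc_union[of p] by metis
qed

lemma small_empty: "small {}"
  by (rule small_subset[OF small_range empty_subsetI])

lemma small_UN_finite: "finite I \<Longrightarrow> (\<And>i. i \<in> I \<Longrightarrow> small (F i)) \<Longrightarrow> small (\<Union>i\<in>I. F i)"
  by (induction I rule: finite_induct) (simp_all add: small_empty small_Un)

lemma small_finite:
  assumes "finite X"
  shows "small X"
proof -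
  have "small {x}" for x :: 'a
    using small_range[of "\<lambda>_. x"] by simp
  then have "small (\<Union>x\<in>X. {x})" using assms by (intro small_UN_finite) auto
  then show ?thesis by simp
qed

lemma small_pow_star:
  assumes "small (\<Union>X)"
  shows "small (pow_star X)"
proof -
  obtain x where "elts x = \<Union>X" using assms unfolding small_def by blast
  then have "small {z. elts z \<subseteq> \<Union>X}"
    unfolding small_def using zfc_powerset[of x] by simp
  then show ?thesis by (rule small_subset) (auto simp: pow_star_def)
qed

lemma elts_induct:
  assumes "\<And>x. (\<And>y. y \<in> elts x \<Longrightarrow> R y) \<Longrightarrow> R x"
  shows "R x"
  using zfc_foundation
proof (induction x rule: wf_induct_rule)
  case (less x)
  show ?case
  proof (rule assms)
    fix y assume "y \<in> elts x"
    then show "R y" by (intro less) simp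
  qed
qed

lemma elts_chain_inj:
  fixes y :: "nat \<Rightarrow> 'v::zfc_universe"
  assumes "\<And>k. y k \<in> elts (y (Suc k))"
  shows "inj y"
proof -
  have "(y j, y (j + Suc d)) \<in> {(x, y). x \<in> elts y}\<^sup>+" for j d
    by (induction d) (use assms in \<open>auto intro: trancl_into_trancl\<close>)
  then have "y j \<noteq> y k" if "j < k" for j k
    using wf_acyclic[OF zfc_foundation] that
    by (metis acyclic_def less_iff_Suc_add add_Suc_right)
  then show ?thesis
    by (metis injI linorder_neqE_nat)
qed

section \<open>Pumped blocks\<close>

text \<open>
  This collects what the construction uses of a formative process: the final blocks \<open>b\<close>, the
  stage \<open>e x\<close> at which an element enters, the \<open>\<wp>\<close>-nodes \<open>Q\<close>, a closed set \<open>W\<close> with a choice \<open>g\<close> of local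
  trashes, and the places \<open>K\<close> of the cycle. The cycle is unrolled into an infinite walk
  \<open>pl 0, nd 0, pl 1, nd 1, \<dots>\<close> starting at the place of \<open>z\<close>. Grand events appear as entry stages of unions of
  blocks; this is why \<open>trash_time\<close> and \<open>cycle_time\<close> speak only of unions that enter the process.
\<close>

locale pumping =
  fixes P :: "'p set"
    and b :: "'p \<Rightarrow> 'v::zfc_universe set"
    and e :: "'v \<Rightarrow> nat"
    and i\<^sub>0 L :: nat
    and Q :: "'p set set"
    and W K :: "'p set"
    and g :: "'p set \<Rightarrow> 'p"
    and pl :: "nat \<Rightarrow> 'p"
    and nd :: "nat \<Rightarrow> 'p set"
    and z :: 'v
    and rep :: "'p \<Rightarrow> 'v"
  assumes finite_P: "finite P"
    and small_b: "q \<in> P \<Longrightarrow> small (b q)"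
    and b_nonempty: "q \<in> P \<Longrightarrow> b q \<noteq> {}"
    and b_disjoint: "p \<in> P \<Longrightarrow> q \<in> P \<Longrightarrow> x \<in> b p \<Longrightarrow> x \<in> b q \<Longrightarrow> p = q"
    and U_trans: "x \<in> \<Union>(b ` P) \<Longrightarrow> y \<in> elts x \<Longrightarrow> y \<in> \<Union>(b ` P)"
    and e_less: "x \<in> \<Union>(b ` P) \<Longrightarrow> y \<in> elts x \<Longrightarrow> e y < e x"
    and e_bound: "x \<in> \<Union>(b ` P) \<Longrightarrow> e x < L"
    and Q_sub: "A \<in> Q \<Longrightarrow> A \<subseteq> P"
    and Q_pow: "A \<in> Q \<Longrightarrow> pow_star (b ` A) \<subseteq> \<Union>(b ` P)"
    and W_sub: "W \<subseteq> P"
    and K_sub: "K \<subseteq> W"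
    and trash_W: "A \<in> Q \<Longrightarrow> A \<inter> W \<noteq> {} \<Longrightarrow> g A \<in> W"
    and trash_target: "A \<in> Q \<Longrightarrow> A \<inter> W \<noteq> {} \<Longrightarrow> g A \<in> induced_target P b A"
    and trash_time: "A \<in> Q \<Longrightarrow> A \<inter> W \<noteq> {} \<Longrightarrow> B \<subseteq> P \<Longrightarrow> g A \<in> B \<Longrightarrow>
          to_set (\<Union>(b ` B)) \<in> \<Union>(b ` P) \<Longrightarrow> e (to_set (\<Union>(b ` A))) < e (to_set (\<Union>(b ` B)))"
    and cycle_time: "A \<subseteq> P \<Longrightarrow> A \<inter> K \<noteq> {} \<Longrightarrow> to_set (\<Union>(b ` A)) \<in> \<Union>(b ` P) \<Longrightarrow>
          i\<^sub>0 \<le> e (to_set (\<Union>(b ` A)))"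
    and pl_K: "pl k \<in> K"
    and nd_sub: "nd k \<subseteq> P"
    and pl_nd: "pl k \<in> nd k"
    and pl_target: "pl (Suc k) \<in> induced_target P b (nd k)"
    and pl_infinite: "q \<in> K \<Longrightarrow> infinite {k. pl k = q}"
    and z_b: "z \<in> b (pl 0)"
    and z_early: "e z < i\<^sub>0"
    and z_fresh: "x \<in> \<Union>(b ` P) \<Longrightarrow> e x < i\<^sub>0 \<Longrightarrow> z \<notin> elts x"
    and rep_b: "p \<in> nd k \<Longrightarrow> rep p \<in> b p"
    and rep_early: "p \<in> nd k \<Longrightarrow> e (rep p) < i\<^sub>0"
begin

abbreviation U :: "'v set" where
  "U \<equiv> \<Union>(b ` P)"

abbreviation join :: "'p set \<Rightarrow> 'v" where
  "join A \<equiv> to_set (\<Union>(b ` A))"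

definition trace :: "'v \<Rightarrow> 'p set" where
  "trace x = {p \<in> P. elts x \<inter> b p \<noteq> {}}"

primrec chain :: "nat \<Rightarrow> 'v" where
  "chain 0 = z"
| "chain (Suc k) = to_set (insert (chain k) (rep ` nd k))"

text \<open>
  The start \<open>chain 0 = z\<close> is an old element, so the surplus begins with \<open>chain 1\<close>.
\<close>

definition cycle_part :: "'p \<Rightarrow> 'v set" where
  "cycle_part q = {chain (Suc k) | k. pl (Suc k) = q}"

text \<open>
  A copy that contains two surplus elements differs from every chain element, since a chain element
  contains at most one, its predecessor. This separates the copies of late elements from the chain.
\<close>

definition markers :: "'p set \<Rightarrow> 'v set" where
  "markers A = (if A \<inter> K = {} then {} else SOME E. E \<subseteq> (\<Union>q\<in>A. cycle_part q) \<and> card E = 2)"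

text \<open>
  One step of the recursion: the copy of \<open>x\<close>, given copies \<open>f\<close> of the elements that enter earlier
  and the surplus accumulated so far. The second case is that of a union of blocks.
\<close>

definition new_value :: "('v \<Rightarrow> 'v) \<Rightarrow> ('p \<Rightarrow> 'v set) \<Rightarrow> 'v \<Rightarrow> 'v" where
  "new_value f surplus x =
     (if e x < i\<^sub>0 then x
      else if elts x = \<Union>(b ` trace x) then to_set (\<Union>q\<in>trace x. f ` b q \<union> surplus q)
      else to_set (f ` elts x \<union> markers (trace x)))"

text \<open>
  The elements that a node passes on to its local trash: the members of \<open>pow_star\<close> of its new blocks
  that are neither copies nor chain elements.
\<close>

definition new_trash :: "('v \<Rightarrow> 'v) \<Rightarrow> ('p \<Rightarrow> 'v set) \<Rightarrow> 'p set \<Rightarrow> 'v set" where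
  "new_trash f surplus A =
     pow_star ((\<lambda>q. f ` b q \<union> surplus q) ` A) - new_value f surplus ` pow_star (b ` A) - range (\<lambda>k. chain (Suc k))"

text \<open>
  By \<open>cycle_time\<close> and \<open>trash_time\<close>, no surplus reaches a node whose grand event precedes \<open>i\<^sub>0\<close>.
  Only the later ones have to pass anything on, which keeps the construction constant below \<open>i\<^sub>0\<close>.
\<close>

definition affected :: "'p set set" where
  "affected = {A \<in> Q. A \<inter> W \<noteq> {} \<and> i\<^sub>0 \<le> e (join A)}"

text \<open>
  Step \<open>k\<close> handles the elements and the grand events of stage \<open>i\<^sub>0 + k\<close>. As elements enter before
  stage \<open>L\<close>, the state after \<open>L\<close> steps is final.
\<close>

primrec state :: "nat \<Rightarrow> ('v \<Rightarrow> 'v) \<times> ('p \<Rightarrow> 'v set)" where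
  "state 0 = ((\<lambda>x. x), cycle_part)"
| "state (Suc k) =
     ((\<lambda>x. if e x = i\<^sub>0 + k then new_value (fst (state k)) (snd (state k)) x else fst (state k) x),
      (\<lambda>q. snd (state k) q \<union>
           (\<Union>A\<in>{A \<in> affected. g A = q \<and> e (join A) = i\<^sub>0 + k}.
              new_trash (fst (state k)) (snd (state k)) A)))"

definition \<phi> :: "'v \<Rightarrow> 'v" where "\<phi> = fst (state L)"

definition surplus :: "'p \<Rightarrow> 'v set" where "surplus = snd (state L)"

definition trash_of :: "'p set \<Rightarrow> 'v set" where "trash_of A = new_trash \<phi> surplus A"

definition hat :: "'p \<Rightarrow> 'v set" where "hat q = \<phi> ` b q \<union> surplus q"

lemma small_Ub: "A \<subseteq> P \<Longrightarrow> small (\<Union>(b ` A))"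
  by (intro small_UN_finite) (auto intro: small_b finite_subset[OF _ finite_P])

lemma elts_join: "A \<subseteq> P \<Longrightarrow> elts (join A) = \<Union>(b ` A)"
  by (intro elts_to_set small_Ub)

lemma trace_sub: "trace x \<subseteq> P"
  unfolding trace_def by blast

lemma trace_pow_star: "A \<subseteq> P \<Longrightarrow> x \<in> pow_star (b ` A) \<Longrightarrow> trace x = A"
  using b_disjoint unfolding trace_def pow_star_def by blast

lemma pow_star_trace: "x \<in> U \<Longrightarrow> x \<in> pow_star (b ` trace x)"
  using U_trans unfolding trace_def pow_star_def by blast

lemma join_pow_star: "A \<subseteq> P \<Longrightarrow> join A \<in> pow_star (b ` A)"
  using b_nonempty unfolding pow_star_def by (simp add: elts_join) blast

lemma join_U: "A \<in> Q \<Longrightarrow> join A \<in> U"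
  using Q_pow[of A] join_pow_star[OF Q_sub[of A]] by blast

lemma join_trace: "elts x = \<Union>(b ` trace x) \<Longrightarrow> join (trace x) = x"
  using to_set_elts[of x] by simp

lemma affectedD: "A \<in> affected \<Longrightarrow> A \<in> Q \<and> A \<inter> W \<noteq> {} \<and> i\<^sub>0 \<le> e (join A) \<and> A \<subseteq> P"
  using Q_sub unfolding affected_def by blast

lemma finite_affected: "finite affected"
  by (rule finite_subset[of _ "Pow P"]) (use finite_P affectedD in auto)

lemma nd_finite: "finite (nd k)"
  using nd_sub finite_P finite_subset by blast

lemma elts_chain: "elts (chain (Suc k)) = insert (chain k) (rep ` nd k)"
  by (simp add: elts_to_set small_finite nd_finite)

declare chain.simps(2) [simp del]

lemma chain_inj: "inj chain"
  by (rule elts_chain_inj) (simp add: elts_chain)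

text \<open>
  If a chain element were an old element from before stage \<open>i\<^sub>0\<close>, so would be all chain elements
  below it, and the first of them contains \<open>z\<close>.
\<close>

lemma chain_late: "chain (Suc k) \<in> U \<Longrightarrow> i\<^sub>0 \<le> e (chain (Suc k))"
proof (induction k)
  case 0
  then show ?case using z_fresh elts_chain[of 0] by (metis insertI1 not_le chain.simps(1))
next
  case (Suc k)
  have "chain (Suc k) \<in> elts (chain (Suc (Suc k)))" by (simp add: elts_chain)
  then have "chain (Suc k) \<in> U" "e (chain (Suc k)) < e (chain (Suc (Suc k)))"
    using U_trans[OF Suc.prems] e_less[OF Suc.prems] by blast+
  then show ?case using Suc.IH by linarith
qed

lemma pl_P: "pl k \<in> P"
  using pl_K K_sub W_sub by blast

lemma cycle_part_infinite:
  assumes "q \<in> K"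
  shows "infinite (cycle_part q)"
proof -
  have "infinite {k. pl (Suc k) = q}"
  proof
    assume "finite {k. pl (Suc k) = q}"
    then have "finite (insert 0 (Suc ` {k. pl (Suc k) = q}))" by simp
    moreover have "{k. pl k = q} \<subseteq> insert 0 (Suc ` {k. pl (Suc k) = q})"
      using not0_implies_Suc by fastforce
    ultimately show False using pl_infinite[OF assms] finite_subset by blast
  qed
  moreover have "inj (\<lambda>k. chain (Suc k))"
    using chain_inj unfolding inj_def by blast
  ultimately have "infinite ((\<lambda>k. chain (Suc k)) ` {k. pl (Suc k) = q})"
    using finite_imageD inj_on_subset by blast
  then show ?thesis by (simp add: cycle_part_def setcompr_eq_image)
qed

lemma cycle_part_outside: "q \<notin> K \<Longrightarrow> cycle_part q = {}"
  using pl_K unfolding cycle_part_def by blast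

lemma cycle_part_range: "cycle_part q \<subseteq> range (\<lambda>k. chain (Suc k))"
  unfolding cycle_part_def by blast

lemma markers_none: "A \<inter> K = {} \<Longrightarrow> markers A = {}"
  by (simp add: markers_def)

lemma markers_some:
  assumes "A \<inter> K \<noteq> {}"
  shows "markers A \<subseteq> (\<Union>q\<in>A. cycle_part q)" "card (markers A) = 2"
proof -
  obtain q where q: "q \<in> A" "q \<in> K" using assms by blast
  obtain E where "E \<subseteq> cycle_part q" "card E = 2"
    using infinite_arbitrarily_large[OF cycle_part_infinite[OF q(2)]] by blast
  then have "\<exists>E. E \<subseteq> (\<Union>q\<in>A. cycle_part q) \<and> card E = 2" using q by blast
  from someI_ex[OF this] assms
  show "markers A \<subseteq> (\<Union>q\<in>A. cycle_part q)" "card (markers A) = 2"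
    by (simp_all add: markers_def)
qed

lemma markers_sub: "markers A \<subseteq> (\<Union>q\<in>A. cycle_part q)"
  using markers_none markers_some(1) by (cases "A \<inter> K = {}") auto

lemma markers_finite: "finite (markers A)"
  using markers_none markers_some(2) by (metis card.infinite finite.emptyI zero_neq_numeral)

section \<open>The recursion reaches a fixed point\<close>

text \<open>
  The recursion step for \<open>x\<close> looks at \<open>f\<close> only on the elements of \<open>x\<close>, and at the surplus only if
  \<open>x\<close> is a union of blocks.
\<close>

lemma new_value_cong:
  assumes "\<And>u. u \<in> elts x \<Longrightarrow> f u = f' u"
    and "i\<^sub>0 \<le> e x \<Longrightarrow> elts x = \<Union>(b ` trace x) \<Longrightarrow> \<forall>q\<in>trace x. T q = T' q"
  shows "new_value f T x = new_value f' T' x"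
proof -
  have "f ` elts x = f' ` elts x" using assms(1) by (intro image_cong) auto
  moreover have "(\<Union>q\<in>trace x. f ` b q \<union> T q) = (\<Union>q\<in>trace x. f' ` b q \<union> T' q)"
    if g: "i\<^sub>0 \<le> e x" "elts x = \<Union>(b ` trace x)"
  proof (rule SUP_cong[OF refl])
    fix q assume q: "q \<in> trace x"
    then have "b q \<subseteq> elts x" using g(2) by blast
    then have "f ` b q = f' ` b q" using assms(1) by (intro image_cong) auto
    then show "f ` b q \<union> T q = f' ` b q \<union> T' q" using assms(2) g q by simp
  qed
  ultimately show ?thesis unfolding new_value_def by auto
qed

lemma fst_state_early: "e x < i\<^sub>0 \<Longrightarrow> fst (state k) x = x"
  by (induction k) auto

lemma fst_state_stable:
  assumes "e x < i\<^sub>0 + k"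
  shows "fst (state (k + d)) x = fst (state k) x"
  using assms by (induction d) auto

text \<open>
  A node that feeds \<open>q\<close> after the grand event of \<open>A\<close> would have \<open>q\<close> as local trash, hence its own
  grand event would precede that of \<open>A\<close>.
\<close>

lemma snd_state_stable:
  assumes "A \<subseteq> P" "q \<in> A" "join A \<in> U" "e (join A) = i\<^sub>0 + k"
  shows "snd (state (k + d)) q = snd (state k) q"
proof (induction d)
  case (Suc d)
  have empty: "{B \<in> affected. g B = q \<and> e (join B) = i\<^sub>0 + (k + d)} = {}"
  proof -
    have False if "B \<in> affected" "g B = q" "e (join B) = i\<^sub>0 + (k + d)" for B
      using trash_time[of B A] affectedD[OF that(1)] that assms by auto
    then show ?thesis by blast
  qed
  show ?case unfolding add_Suc_right state.simps(2) snd_conv empty using Suc by simp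
qed simp

lemma \<phi>_eq_state: "e x < i\<^sub>0 + k \<Longrightarrow> k \<le> L \<Longrightarrow> \<phi> x = fst (state k) x"
  using fst_state_stable[of x k "L - k"] by (simp add: \<phi>_def)

lemma surplus_eq_state:
  "A \<subseteq> P \<Longrightarrow> q \<in> A \<Longrightarrow> join A \<in> U \<Longrightarrow> e (join A) = i\<^sub>0 + k \<Longrightarrow> k \<le> L \<Longrightarrow> surplus q = snd (state k) q"
  using snd_state_stable[of A q k "L - k"] by (simp add: surplus_def)

lemma \<phi>_early: "e x < i\<^sub>0 \<Longrightarrow> \<phi> x = x"
  by (simp add: \<phi>_def fst_state_early)

lemma \<phi>_fixed_point:
  assumes "x \<in> U"
  shows "\<phi> x = new_value \<phi> surplus x"
proof (cases "e x < i\<^sub>0")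
  case True
  then show ?thesis by (simp add: \<phi>_early new_value_def)
next
  case False
  then obtain k where k: "e x = i\<^sub>0 + k" by (metis le_Suc_ex not_less)
  have kL: "Suc k \<le> L" using e_bound[OF assms] k by simp
  have "\<phi> x = fst (state (Suc k)) x" using k kL by (intro \<phi>_eq_state) auto
  also have "\<dots> = new_value (fst (state k)) (snd (state k)) x" using k by simp
  also have "\<dots> = new_value \<phi> surplus x"
  proof (rule new_value_cong)
    fix u assume "u \<in> elts x"
    then show "fst (state k) u = \<phi> u"
      using e_less[OF assms] k kL by (intro \<phi>_eq_state[symmetric]) auto
  next
    assume *: "elts x = \<Union>(b ` trace x)"
    show "\<forall>q\<in>trace x. snd (state k) q = surplus q"
      using surplus_eq_state[OF trace_sub[of x]] join_trace[OF *] assms k kL by force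
  qed
  finally show ?thesis .
qed

lemma new_trash_state:
  assumes A: "A \<in> affected" and k: "e (join A) = i\<^sub>0 + k"
  shows "new_trash (fst (state k)) (snd (state k)) A = trash_of A"
proof -
  note a = affectedD[OF A]
  have jU: "join A \<in> U" using a join_U by blast
  have kL: "k \<le> L" using e_bound[OF jU] k by simp
  have f: "fst (state k) u = \<phi> u" if "u \<in> \<Union>(b ` A)" for u
    using e_less[OF jU] that a elts_join[of A] k kL by (intro \<phi>_eq_state[symmetric]) auto
  have s: "snd (state k) q = surplus q" if "q \<in> A" for q
    using surplus_eq_state[of A q k] a jU k kL that by simp
  have 1: "(\<lambda>q. fst (state k) ` b q \<union> snd (state k) q) ` A = (\<lambda>q. \<phi> ` b q \<union> surplus q) ` A"
  proof (rule image_cong[OF refl])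
    fix q assume "q \<in> A"
    moreover then have "fst (state k) ` b q = \<phi> ` b q" using f by (intro image_cong) auto
    ultimately show "fst (state k) ` b q \<union> snd (state k) q = \<phi> ` b q \<union> surplus q" using s by simp
  qed
  have 2: "new_value (fst (state k)) (snd (state k)) ` pow_star (b ` A) = new_value \<phi> surplus ` pow_star (b ` A)"
  proof (intro image_cong[OF refl] new_value_cong)
    fix x u assume "x \<in> pow_star (b ` A)" "u \<in> elts x"
    then show "fst (state k) u = \<phi> u" using f unfolding pow_star_def by blast
  next
    fix x assume "x \<in> pow_star (b ` A)"
    then show "\<forall>q\<in>trace x. snd (state k) q = surplus q" using s trace_pow_star a by blast
  qed
  show ?thesis unfolding trash_of_def new_trash_def 1 2 ..
qed

lemma trash_of_eq:
  assumes "A \<in> affected"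
  shows "trash_of A = pow_star (hat ` A) - \<phi> ` pow_star (b ` A) - range (\<lambda>k. chain (Suc k))"
proof -
  have "new_value \<phi> surplus ` pow_star (b ` A) = \<phi> ` pow_star (b ` A)"
  proof (rule image_cong[OF refl])
    fix x assume "x \<in> pow_star (b ` A)"
    then have "x \<in> U" using Q_pow affectedD[OF assms] by blast
    then show "new_value \<phi> surplus x = \<phi> x" by (simp add: \<phi>_fixed_point)
  qed
  then show ?thesis unfolding trash_of_def new_trash_def hat_def by simp
qed

lemma snd_state_sum:
  "snd (state k) q = cycle_part q \<union> (\<Union>A\<in>{A \<in> affected. g A = q \<and> e (join A) < i\<^sub>0 + k}. trash_of A)"
proof (induction k)
  case 0
  then show ?case using affectedD by fastforce
next
  case (Suc k)
  have "snd (state (Suc k)) q = snd (state k) q \<union> (\<Union>A\<in>{A \<in> affected. g A = q \<and> e (join A) = i\<^sub>0 + k}. trash_of A)"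
    using new_trash_state by (simp cong: SUP_cong_simp)
  also have "\<dots> = cycle_part q \<union> (\<Union>A\<in>{A \<in> affected. g A = q \<and> e (join A) < i\<^sub>0 + Suc k}. trash_of A)"
    unfolding Suc by (auto simp: less_Suc_eq)
  finally show ?case .
qed

lemma surplus_eq: "surplus q = cycle_part q \<union> (\<Union>A\<in>{A \<in> affected. g A = q}. trash_of A)"
proof -
  have "e (join A) < i\<^sub>0 + L" if "A \<in> affected" for A
    using e_bound[OF join_U] affectedD[OF that] by (simp add: trans_less_add2)
  then have "{A \<in> affected. g A = q} = {A \<in> affected. g A = q \<and> e (join A) < i\<^sub>0 + L}"
    by blast
  then show ?thesis unfolding surplus_def snd_state_sum by simp
qed

lemma small_surplus_state: "q \<in> P \<Longrightarrow> small (snd (state k) q)"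
proof (induction k arbitrary: q)
  case 0
  show ?case using small_subset[OF small_range cycle_part_range] by simp
next
  case (Suc k)
  have "small (new_trash (fst (state k)) (snd (state k)) A)" if "A \<in> affected" for A
  proof -
    have "A \<subseteq> P" using affectedD that by blast
    then have "small (\<Union>q\<in>A. fst (state k) ` b q \<union> snd (state k) q)"
      using Suc.IH small_b finite_subset[OF _ finite_P]
      by (intro small_UN_finite small_Un small_image) auto
    from small_pow_star[OF this] show ?thesis
      by (rule small_subset) (auto simp: new_trash_def)
  qed
  moreover have "finite {A \<in> affected. g A = q \<and> e (join A) = i\<^sub>0 + k}"
    using finite_affected by simp
  ultimately show ?case using Suc by (auto intro!: small_Un small_UN_finite)
qed

lemma small_Uhat:
  assumes "A \<subseteq> P"
  shows "small (\<Union>(hat ` A))"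
proof (rule small_UN_finite)
  show "finite A" by (rule finite_subset[OF assms finite_P])
next
  fix q assume "q \<in> A"
  then have "q \<in> P" using assms by blast
  then show "small (hat q)"
    unfolding hat_def surplus_def using small_Un[OF small_image[OF small_b] small_surplus_state] by blast
qed

section \<open>Shape of the new elements\<close>

lemma cycle_part_sub_surplus: "cycle_part q \<subseteq> surplus q"
  unfolding surplus_eq by blast

lemma surplus_sub_hat: "surplus q \<subseteq> hat q"
  unfolding hat_def by blast

lemma \<phi>_hat: "x \<in> b q \<Longrightarrow> \<phi> x \<in> hat q"
  unfolding hat_def by blast

lemma surplus_outside:
  assumes "q \<notin> W"
  shows "surplus q = {}"
proof -
  have "q \<notin> K" using K_sub assms by blast
  then have "cycle_part q = {}" by (rule cycle_part_outside)
  moreover have "\<not> (A \<in> affected \<and> g A = q)" for A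
    using trash_W[of A] affectedD[of A] assms by blast
  ultimately show ?thesis unfolding surplus_eq by auto
qed

text \<open>
  Both sources of surplus are excluded by time: a node meeting the cycle has its grand event at
  \<open>i\<^sub>0\<close> or later, and affected nodes feeding a place of \<open>A\<close> would precede \<open>A\<close> but not \<open>i\<^sub>0\<close>.
\<close>

lemma surplus_early:
  assumes A: "A \<subseteq> P" "q \<in> A" and j: "join A \<in> U" "e (join A) < i\<^sub>0"
  shows "surplus q = {}"
proof -
  have "q \<notin> K" using cycle_time[OF A(1) _ j(1)] A(2) j(2) by fastforce
  moreover have False if "B \<in> affected" "g B = q" for B
    using trash_time[of B A] affectedD[OF that(1)] that(2) A j by fastforce
  ultimately show ?thesis unfolding surplus_eq using cycle_part_outside[of q] by auto
qed

lemma surplus_unaffected: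
  assumes "A \<in> Q" "A \<notin> affected" "q \<in> A"
  shows "surplus q = {}"
proof (cases "A \<inter> W = {}")
  case True
  then show ?thesis using assms surplus_outside by blast
next
  case False
  then have "e (join A) < i\<^sub>0" using assms unfolding affected_def by simp
  then show ?thesis using surplus_early[OF Q_sub[OF assms(1)] assms(3) join_U[OF assms(1)]] by simp
qed

lemma hat_early:
  assumes "\<And>x. x \<in> b q \<Longrightarrow> e x < i\<^sub>0" "surplus q = {}"
  shows "hat q = b q"
proof -
  have "\<phi> ` b q = (\<lambda>x. x) ` b q" by (intro image_cong refl \<phi>_early assms(1))
  then show ?thesis unfolding hat_def using assms(2) by simp
qed

text \<open>
  For early unions this is a statement about the identity: their places have received no surplus.
\<close>

lemma elts_\<phi>_join:
  assumes "A \<subseteq> P" "join A \<in> U"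
  shows "elts (\<phi> (join A)) = \<Union>(hat ` A)"
proof (cases "e (join A) < i\<^sub>0")
  case True
  have "hat q = b q" if "q \<in> A" for q
  proof (rule hat_early)
    fix x assume "x \<in> b q"
    then have "x \<in> elts (join A)" using elts_join assms that by blast
    then show "e x < i\<^sub>0" using e_less[OF assms(2)] True by fastforce
  qed (use surplus_early assms that True in blast)
  then have "\<Union>(hat ` A) = \<Union>(b ` A)" by simp
  then show ?thesis using True \<phi>_early elts_join assms by simp
next
  case False
  have t: "trace (join A) = A"
    using trace_pow_star join_pow_star assms(1) by blast
  have "\<phi> (join A) = to_set (\<Union>(hat ` A))"
    unfolding \<phi>_fixed_point[OF assms(2)] new_value_def t
    using False elts_join[OF assms(1)] by (simp add: hat_def)
  then show ?thesis using elts_to_set[OF small_Uhat[OF assms(1)]] by simp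
qed

lemma elts_\<phi>_join_split:
  assumes "x \<in> U" "elts x = \<Union>(b ` trace x)"
  shows "elts (\<phi> x) = \<phi> ` elts x \<union> (\<Union>q\<in>trace x. surplus q)"
proof -
  have "elts (\<phi> x) = \<Union>(hat ` trace x)"
    using elts_\<phi>_join[OF trace_sub, of x] join_trace assms by simp
  also have "\<dots> = \<phi> ` \<Union>(b ` trace x) \<union> (\<Union>q\<in>trace x. surplus q)"
    unfolding hat_def by (simp only: image_UN UN_Un_distrib)
  finally show ?thesis using assms(2) by simp
qed

lemma elts_\<phi>_other:
  assumes x: "x \<in> U" and ne: "elts x \<noteq> \<Union>(b ` trace x)"
  shows "elts (\<phi> x) = \<phi> ` elts x \<union> (if e x < i\<^sub>0 then {} else markers (trace x))"
proof (cases "e x < i\<^sub>0")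
  case True
  then have "\<phi> u = u" if "u \<in> elts x" for u
    using e_less[OF x that] by (simp add: \<phi>_early)
  then show ?thesis using True by (simp add: \<phi>_early)
next
  case False
  then have "\<phi> x = to_set (\<phi> ` elts x \<union> markers (trace x))"
    using ne unfolding \<phi>_fixed_point[OF x] new_value_def by simp
  moreover have "small (\<phi> ` elts x \<union> markers (trace x))"
    by (intro small_Un small_image small_elts small_finite markers_finite)
  ultimately show ?thesis using False by (simp add: elts_to_set)
qed

lemma \<phi>_image_sub: 
  assumes "x \<in> U"
  shows "\<phi> ` elts x \<subseteq> elts (\<phi> x)"
proof (cases "elts x = \<Union>(b ` trace x)")
  case True
  then show ?thesis using elts_\<phi>_join_split assms by blast
qed (use elts_\<phi>_other assms in simp)

lemma elts_\<phi>_sub: 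
  assumes "x \<in> U"
  shows "elts (\<phi> x) \<subseteq> \<phi> ` elts x \<union> (\<Union>q\<in>trace x. surplus q)"
proof (cases "elts x = \<Union>(b ` trace x)")
  case True
  then show ?thesis using elts_\<phi>_join_split assms by blast
next
  case False
  have "markers (trace x) \<subseteq> (\<Union>q\<in>trace x. surplus q)"
    using markers_sub cycle_part_sub_surplus by blast
  then show ?thesis using elts_\<phi>_other[OF assms False] by auto
qed

lemma \<phi>_pow_star:
  assumes "x \<in> U"
  shows "\<phi> x \<in> pow_star (hat ` trace x)"
proof -
  have x: "elts x \<subseteq> \<Union>(b ` trace x)" "\<forall>q\<in>trace x. elts x \<inter> b q \<noteq> {}"
    using pow_star_trace[OF assms] unfolding pow_star_def by auto
  have "\<phi> ` elts x \<subseteq> \<Union>(hat ` trace x)"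
    using x(1) \<phi>_hat by blast
  moreover have "(\<Union>q\<in>trace x. surplus q) \<subseteq> \<Union>(hat ` trace x)"
    using surplus_sub_hat by blast
  ultimately have "elts (\<phi> x) \<subseteq> \<Union>(hat ` trace x)"
    using elts_\<phi>_sub[OF assms] by (meson Un_least order_trans)
  moreover have "elts (\<phi> x) \<inter> hat q \<noteq> {}" if "q \<in> trace x" for q
  proof -
    have "elts x \<inter> b q \<noteq> {}" using x(2) that by blast
    then obtain u where "u \<in> elts x" "u \<in> b q" by blast
    then show ?thesis using \<phi>_image_sub[OF assms] \<phi>_hat by blast
  qed
  ultimately show ?thesis unfolding pow_star_def by blast
qed

lemma finite_elts_chain: "finite (elts (chain (Suc k)))"
  by (simp add: elts_chain nd_finite)

lemma chain_pow_star: "chain (Suc k) \<in> pow_star (hat ` nd k)"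
proof -
  have yk: "chain k \<in> hat (pl k)"
  proof (cases k)
    case 0
    then show ?thesis using \<phi>_hat[OF z_b] \<phi>_early[OF z_early] by simp
  next
    case (Suc l)
    then have "chain k \<in> cycle_part (pl k)" unfolding cycle_part_def by blast
    then show ?thesis using cycle_part_sub_surplus surplus_sub_hat by blast
  qed
  have rep: "rep p \<in> hat p" if "p \<in> nd k" for p
    using \<phi>_hat[OF rep_b[OF that]] \<phi>_early[OF rep_early[OF that]] by simp
  show ?thesis
    unfolding pow_star_def using elts_chain[of k] yk rep pl_nd[of k] by auto
qed

section \<open>New elements do not collide\<close>

text \<open>
  The invariant of the induction along \<open>\<in>\<close>: a separated set has at most one preimage under \<open>\<phi>\<close>, is
  not both a copy and a surplus element, and is surplus of at most one place. In particular it lies in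
  at most one new block.
\<close>

definition separated :: "'v \<Rightarrow> bool" where
  "separated v \<longleftrightarrow>
     (\<forall>x\<in>U. \<forall>x'\<in>U. v = \<phi> x \<longrightarrow> v = \<phi> x' \<longrightarrow> x = x') \<and>
     (\<forall>q. v \<in> \<phi> ` U \<longrightarrow> v \<notin> surplus q) \<and>
     (\<forall>q q'. v \<in> surplus q \<longrightarrow> v \<in> surplus q' \<longrightarrow> q = q')"

lemma separated_inj:
  assumes "separated (\<phi> x)" "x \<in> U" "x' \<in> U" "\<phi> x = \<phi> x'"
  shows "x = x'"
proof -
  have "\<forall>a\<in>U. \<forall>a'\<in>U. \<phi> x = \<phi> a \<longrightarrow> \<phi> x = \<phi> a' \<longrightarrow> a = a'"
    using assms(1) unfolding separated_def by (elim conjE)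
  then show ?thesis using assms(2-4) by blast
qed

lemma separated_hat:
  assumes "separated v" "p \<in> P" "q \<in> P" "v \<in> hat p" "v \<in> hat q"
  shows "p = q"
proof (cases "v \<in> \<phi> ` U")
  case True
  then have "v \<in> \<phi> ` b p" "v \<in> \<phi> ` b q"
    using assms unfolding separated_def hat_def by auto
  then obtain x x' where "x \<in> b p" "x' \<in> b q" "v = \<phi> x" "v = \<phi> x'" by blast
  then have "x = x'" using assms unfolding separated_def by blast
  then show ?thesis using \<open>x \<in> b p\<close> \<open>x' \<in> b q\<close> b_disjoint assms by blast
next
  case False
  then have "v \<in> surplus p" "v \<in> surplus q" using assms unfolding hat_def by auto
  then show ?thesis using assms(1) unfolding separated_def by blast
qed

text \<open>
  The old elements can be read off from a copy: all that \<open>\<phi>\<close> adds to the image of \<open>x\<close> is surplus,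
  and surplus elements are not copies. This yields both the injectivity of \<open>\<phi>\<close> and the recognition of
  unions of blocks.
\<close>

lemma elts_\<phi>_Int:
  assumes x: "x \<in> U" and sep: "\<And>w. w \<in> elts (\<phi> x) \<Longrightarrow> separated w"
  shows "elts (\<phi> x) \<inter> \<phi> ` U = \<phi> ` elts x"
proof
  have "elts x \<subseteq> U" using U_trans[OF x] by blast
  then show "\<phi> ` elts x \<subseteq> elts (\<phi> x) \<inter> \<phi> ` U"
    using \<phi>_image_sub[OF x] by blast
  show "elts (\<phi> x) \<inter> \<phi> ` U \<subseteq> \<phi> ` elts x"
  proof
    fix w assume w: "w \<in> elts (\<phi> x) \<inter> \<phi> ` U"
    then have "w \<notin> surplus q" for q using sep[of w] unfolding separated_def by simp
    then show "w \<in> \<phi> ` elts x" using elts_\<phi>_sub[OF x] w by blast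
  qed
qed

text \<open>
  The node of a set is the collection of places that its elements come from.
\<close>

lemma separated_pow_star:
  assumes "\<And>w. w \<in> elts v \<Longrightarrow> separated w"
    and A: "A \<subseteq> P" "v \<in> pow_star (hat ` A)" and B: "B \<subseteq> P" "v \<in> pow_star (hat ` B)"
  shows "A = B"
proof -
  have "A \<subseteq> B" if h: "A \<subseteq> P" "v \<in> pow_star (hat ` A)" "B \<subseteq> P" "v \<in> pow_star (hat ` B)" for A B
  proof
    fix p assume p: "p \<in> A"
    then obtain w where w: "w \<in> elts v" "w \<in> hat p" using h(2) unfolding pow_star_def by blast
    then obtain q where "q \<in> B" "w \<in> hat q" using h(4) unfolding pow_star_def by blast
    moreover then have "p = q"
      using separated_hat[OF assms(1)[OF w(1)], of p q] w(2) h p by blast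
    ultimately show "p \<in> B" by blast
  qed
  then show ?thesis using A B by blast
qed

text \<open>
  A copy that coincides with a chain element has the node of that element, which contains a place
  of the cycle. If it is a union of blocks it is infinite; otherwise it contains two markers. A chain
  element is finite and contains only its predecessor from the surplus.
\<close>

lemma chain_not_\<phi>:
  assumes sep: "\<And>w. w \<in> elts (chain (Suc k)) \<Longrightarrow> separated w" and x: "x \<in> U"
  shows "\<phi> x \<noteq> chain (Suc k)"
proof
  assume eq: "\<phi> x = chain (Suc k)"
  have late: "\<not> e x < i\<^sub>0"
  proof
    assume "e x < i\<^sub>0"
    then have "x = chain (Suc k)" using eq \<phi>_early by simp
    then show False using chain_late[of k] x \<open>e x < i\<^sub>0\<close> by simp
  qed
  have "trace x = nd k"
    using separated_pow_star[OF sep trace_sub _ nd_sub chain_pow_star] \<phi>_pow_star[OF x] eq by metis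
  then have plt: "pl k \<in> trace x" "trace x \<inter> K \<noteq> {}" using pl_nd pl_K by blast+
  show False
  proof (cases "elts x = \<Union>(b ` trace x)")
    case True
    then have "elts (chain (Suc k)) = \<Union>(hat ` trace x)"
      using elts_\<phi>_join[OF trace_sub, of x] join_trace[OF True] x eq by simp
    then have "cycle_part (pl k) \<subseteq> elts (chain (Suc k))"
      using plt cycle_part_sub_surplus surplus_sub_hat by blast
    then have "finite (cycle_part (pl k))" by (rule finite_subset[OF _ finite_elts_chain])
    then show False using cycle_part_infinite[OF pl_K] by blast
  next
    case False
    have r: "rep p \<notin> cycle_part q" if "p \<in> nd k" for p q
    proof
      assume "rep p \<in> cycle_part q"
      then obtain j where j: "rep p = chain (Suc j)" unfolding cycle_part_def by blast
      have "rep p \<in> U" using rep_b nd_sub that by blast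
      then show False using chain_late[of j] rep_early[OF that] j by simp
    qed
    have "markers (trace x) \<subseteq> elts (chain (Suc k))"
      using elts_\<phi>_other[OF x False] late eq by simp
    then have "markers (trace x) \<subseteq> {chain k}"
      using markers_sub[of "trace x"] r elts_chain[of k] by blast
    then have "card (markers (trace x)) \<le> card {chain k}" by (intro card_mono) auto
    then show False using markers_some(2)[OF plt(2)] by simp
  qed
qed

lemma surplus_cases:
  assumes "v \<in> surplus q"
  obtains (cyc) k where "v = chain (Suc k)" "pl (Suc k) = q"
  | (trash) A where "A \<in> affected" "g A = q" "v \<in> trash_of A"
proof -
  from assms consider "v \<in> cycle_part q" | "v \<in> (\<Union>A\<in>{A \<in> affected. g A = q}. trash_of A)"
    unfolding surplus_eq by (elim UnE)
  then show thesis
  proof cases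
    case 1
    then show thesis using cyc unfolding cycle_part_def by blast
  next
    case 2
    then show thesis using trash by blast
  qed
qed

lemma separated_step:
  assumes sep: "\<And>w. w \<in> elts v \<Longrightarrow> separated w"
  shows "separated v"
proof -
  have inj: "x = x'" if h: "x \<in> U" "x' \<in> U" "v = \<phi> x" "v = \<phi> x'" for x x'
  proof -
    have img: "elts v \<inter> \<phi> ` U = \<phi> ` elts a" if a: "a \<in> U" "v = \<phi> a" for a
      by (rule elts_\<phi>_Int[OF a(1), folded a(2), OF sep])
    have sub: "elts x \<subseteq> elts x'" if h: "x \<in> U" "x' \<in> U" "v = \<phi> x" "v = \<phi> x'" for x x'
    proof
      fix u assume u: "u \<in> elts x"
      then have "\<phi> u \<in> \<phi> ` elts x'"
        using img[OF h(1,3)] img[OF h(2,4)] by (metis imageI)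
      then obtain u' where u': "u' \<in> elts x'" "\<phi> u = \<phi> u'" by blast
      have "\<phi> u \<in> elts v" using u \<phi>_image_sub[OF h(1)] h(3) by blast
      then have "separated (\<phi> u)" by (rule sep)
      moreover have "u \<in> U" "u' \<in> U"
        using U_trans[OF h(1) u] U_trans[OF h(2) u'(1)] by blast+
      ultimately have "u = u'" using u'(2) by (rule separated_inj)
      then show "u \<in> elts x'" using u' by simp
    qed
    have "elts x = elts x'" by (rule equalityI[OF sub[OF h] sub[OF h(2,1,4,3)]])
    then show ?thesis by (rule zfc_ext)
  qed
  have R_node: "A = B" if "A \<in> affected" "v \<in> trash_of A" "B \<subseteq> P" "v \<in> pow_star (hat ` B)" for A B
  proof (rule separated_pow_star[OF sep])
    show "A \<subseteq> P" using affectedD[OF that(1)] by simp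
    show "v \<in> pow_star (hat ` A)" using that(2) unfolding trash_of_eq[OF that(1)] by simp
  qed (use that in simp_all)
  have old: "v \<notin> surplus q" if h: "v \<in> \<phi> ` U" for q
  proof
    assume "v \<in> surplus q"
    obtain x where x: "x \<in> U" "v = \<phi> x" using h by blast
    show False using \<open>v \<in> surplus q\<close>
    proof (cases rule: surplus_cases)
      case (cyc k)
      then show False using chain_not_\<phi>[of k x] sep x by simp
    next
      case (trash A)
      have "A = trace x"
        using R_node[OF trash(1,3) trace_sub] \<phi>_pow_star[OF x(1)] x(2) by simp
      then have "v \<in> \<phi> ` pow_star (b ` A)" using pow_star_trace[OF x(1)] x(2) by blast
      then show False using trash(3) unfolding trash_of_eq[OF trash(1)] by blast
    qed
  qed
  have surplus: "q = q'" if "v \<in> surplus q" "v \<in> surplus q'" for q q'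
    using that(1)
  proof (cases rule: surplus_cases)
    case (cyc k)
    note k = this
    show ?thesis using that(2)
    proof (cases rule: surplus_cases)
      case (cyc k')
      then show ?thesis using k chain_inj by (metis injD)
    next
      case (trash A)
      then show ?thesis using k(1) trash_of_eq[of A] by blast
    qed
  next
    case (trash A)
    note A = this
    show ?thesis using that(2)
    proof (cases rule: surplus_cases)
      case (cyc k)
      then show ?thesis using A(3) trash_of_eq[OF A(1)] by blast
    next
      case (trash B)
      then have "A = B"
        using R_node[OF A(1,3), of B] affectedD[of B] trash_of_eq[of B] by blast
      then show ?thesis using A(2) trash(2) by simp
    qed
  qed
  show ?thesis unfolding separated_def using inj old surplus by blast
qed

lemma separated: "separated v"
  by (rule elts_induct) (rule separated_step)

section \<open>The new partition imitates the old one\<close>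

lemma hat_disjoint: "p \<in> P \<Longrightarrow> q \<in> P \<Longrightarrow> v \<in> hat p \<Longrightarrow> v \<in> hat q \<Longrightarrow> p = q"
  using separated_hat separated by blast

lemma hat_nonempty: "q \<in> P \<Longrightarrow> hat q \<noteq> {}"
  using b_nonempty unfolding hat_def by blast

lemma pow_star_hat_unique:
  "A \<subseteq> P \<Longrightarrow> v \<in> pow_star (hat ` A) \<Longrightarrow> B \<subseteq> P \<Longrightarrow> v \<in> pow_star (hat ` B) \<Longrightarrow> A = B"
  using separated_pow_star separated by blast

lemma \<phi>_inj: "x \<in> U \<Longrightarrow> x' \<in> U \<Longrightarrow> \<phi> x = \<phi> x' \<Longrightarrow> x = x'"
  using separated_inj separated by blast

text \<open>
  New elements imitate the arrows of the board: a copy keeps the node of its original, chain elements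
  follow the edges of the cycle, and a local trash is a target of its node.
\<close>

lemma hat_trace:
  assumes "q \<in> P" "v \<in> hat q"
  shows "\<exists>A\<subseteq>P. v \<in> pow_star (hat ` A) \<and> q \<in> induced_target P b A"
proof (cases "v \<in> \<phi> ` b q")
  case True
  then obtain x where x: "x \<in> b q" "v = \<phi> x" by blast
  then have xU: "x \<in> U" using assms by blast
  then have "q \<in> induced_target P b (trace x)"
    using pow_star_trace assms x unfolding induced_target_def by blast
  then show ?thesis using trace_sub \<phi>_pow_star[OF xU] x by blast
next
  case False
  then have "v \<in> surplus q" using assms unfolding hat_def by blast
  then show ?thesis
  proof (cases rule: surplus_cases)
    case (cyc k)
    then show ?thesis using nd_sub chain_pow_star pl_target by blast
  next
    case (trash A)
    then show ?thesis using affectedD[of A] trash_of_eq[of A] trash_target[of A] by blast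
  qed
qed

lemma hat_target:
  assumes "q \<in> P" "v \<in> hat q" "A \<subseteq> P" "v \<in> pow_star (hat ` A)"
  shows "q \<in> induced_target P b A"
  using hat_trace[OF assms(1,2)] pow_star_hat_unique[OF assms(3,4)] by blast

text \<open>
  For an affected node the local trash takes whatever is not there already. The blocks of any other
  \<open>\<wp>\<close>-node are plain copies, and so are all sets assembled from their elements, because the old
  partition contains \<open>pow_star\<close> of the node.
\<close>

lemma pow_star_hat_sub:
  assumes A: "A \<in> Q"
  shows "pow_star (hat ` A) \<subseteq> \<Union>(hat ` P)"
proof
  fix v assume v: "v \<in> pow_star (hat ` A)"
  note AP = Q_sub[OF A]
  show "v \<in> \<Union>(hat ` P)"
  proof (cases "A \<in> affected")
    case True
    have "g A \<in> P" using trash_W W_sub affectedD[OF True] by blast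
    moreover have "trash_of A \<subseteq> hat (g A)" using surplus_sub_hat[of "g A"] True unfolding surplus_eq by blast
    moreover have "chain (Suc k) \<in> hat (pl (Suc k))" for k
      using cycle_part_sub_surplus surplus_sub_hat unfolding cycle_part_def by blast
    moreover have "\<phi> ` pow_star (b ` A) \<subseteq> \<Union>(hat ` P)"
      using Q_pow[OF A] \<phi>_hat by blast
    moreover have "v \<in> trash_of A \<or> v \<in> \<phi> ` pow_star (b ` A) \<or> v \<in> range (\<lambda>k. chain (Suc k))"
      using trash_of_eq[OF True] v by blast
    ultimately show ?thesis using pl_P by blast
  next
    case False
    have hatA: "hat q = \<phi> ` b q" if "q \<in> A" for q
      using surplus_unaffected[OF A False that] unfolding hat_def by simp
    \<comment> \<open>The preimage of \<open>v\<close>, a set of old elements, is the required original.\<close>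
    define X where "X = {u \<in> \<Union>(b ` A). \<phi> u \<in> elts v}"
    obtain x where x: "elts x = X"
      using small_subset[OF small_Ub[OF AP], of X] unfolding small_def X_def by blast
    have "elts v \<subseteq> (\<Union>q\<in>A. \<phi> ` b q)"
      using v hatA unfolding pow_star_def by auto
    then have img: "elts v = \<phi> ` X" unfolding X_def by blast
    have "x \<in> pow_star (b ` A)"
      unfolding pow_star_def mem_Collect_eq x
    proof (intro conjI ballI)
      show "X \<subseteq> \<Union>(b ` A)" unfolding X_def by blast
    next
      fix c assume "c \<in> b ` A"
      then obtain q where q: "q \<in> A" "c = b q" by blast
      then have "elts v \<inter> hat q \<noteq> {}" using v unfolding pow_star_def by blast
      then obtain u where "u \<in> b q" "\<phi> u \<in> elts v" unfolding hatA[OF q(1)] by blast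
      then show "X \<inter> c \<noteq> {}" unfolding X_def using q by blast
    qed
    then have xU: "x \<in> U" and t: "trace x = A" using Q_pow[OF A] trace_pow_star[OF AP] by blast+
    have "(\<Union>q\<in>trace x. surplus q) = {}" using surplus_unaffected[OF A False] t by simp
    then have "elts (\<phi> x) \<subseteq> \<phi> ` elts x"
      using elts_\<phi>_sub[OF xU] by simp
    then have "elts (\<phi> x) = \<phi> ` elts x"
      using \<phi>_image_sub[OF xU] by (rule equalityI)
    then have "\<phi> x = v" using img x by (intro zfc_ext) simp
    then show ?thesis using xU \<phi>_hat by blast
  qed
qed

lemma elts_join_hat: "A \<subseteq> P \<Longrightarrow> elts (to_set (\<Union>(hat ` A))) = \<Union>(hat ` A)"
  by (intro elts_to_set small_Uhat)

lemma \<phi>_join: "A \<subseteq> P \<Longrightarrow> join A \<in> U \<Longrightarrow> \<phi> (join A) = to_set (\<Union>(hat ` A))"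
  by (intro zfc_ext) (simp add: elts_join_hat elts_\<phi>_join)

lemma join_hat_pow_star: "A \<subseteq> P \<Longrightarrow> to_set (\<Union>(hat ` A)) \<in> pow_star (hat ` A)"
  unfolding pow_star_def using hat_nonempty by (simp add: elts_join_hat) blast

text \<open>
  Unions of new blocks are never surplus: at a node of the cycle they are infinite while chain
  elements are finite, and at an affected node they are copies, which the trash leaves out. So such a
  union is a copy, and by \<open>elts_\<phi>_Int\<close> its original is the union of the old blocks.
\<close>

lemma join_hat_mem:
  assumes A: "A \<subseteq> P" and q: "q \<in> P"
  shows "to_set (\<Union>(hat ` A)) \<in> hat q \<longleftrightarrow> join A \<in> b q"
proof
  assume "join A \<in> b q"
  moreover then have "join A \<in> U" using q by blast
  ultimately show "to_set (\<Union>(hat ` A)) \<in> hat q" using \<phi>_join[OF A] \<phi>_hat by metis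
next
  let ?v = "to_set (\<Union>(hat ` A))"
  assume v: "?v \<in> hat q"
  have nS: "?v \<notin> surplus q"
  proof
    assume "?v \<in> surplus q"
    then show False
    proof (cases rule: surplus_cases)
      case (cyc k)
      then have "nd k = A"
        using pow_star_hat_unique[OF nd_sub chain_pow_star A, of k] join_hat_pow_star[OF A] by simp
      then have "hat (pl k) \<subseteq> elts (chain (Suc k))"
        using elts_join_hat[OF A] cyc(1) pl_nd by fastforce
      then have "cycle_part (pl k) \<subseteq> elts (chain (Suc k))" using cycle_part_sub_surplus surplus_sub_hat by blast
      then have "finite (cycle_part (pl k))" by (rule finite_subset[OF _ finite_elts_chain])
      then show False using cycle_part_infinite[OF pl_K] by blast
    next
      case (trash B)
      then have "?v \<in> pow_star (hat ` B)" using trash_of_eq[of B] by blast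
      then have B: "B = A"
        using pow_star_hat_unique[OF _ _ A join_hat_pow_star[OF A]] affectedD[OF trash(1)] by blast
      then have "join A \<in> U" using join_U affectedD[OF trash(1)] by blast
      then have "?v \<in> \<phi> ` pow_star (b ` A)" using \<phi>_join[OF A] join_pow_star[OF A] by force
      then show False using trash(3) trash_of_eq[OF trash(1)] B by blast
    qed
  qed
  then obtain x where x: "x \<in> b q" "?v = \<phi> x" using v unfolding hat_def by blast
  then have xU: "x \<in> U" using q by blast
  have "\<phi> ` elts x = elts ?v \<inter> \<phi> ` U"
    using elts_\<phi>_Int[OF xU separated] x(2) by simp
  also have "\<dots> = \<phi> ` \<Union>(b ` A)"
  proof
    show "\<phi> ` \<Union>(b ` A) \<subseteq> elts ?v \<inter> \<phi> ` U"
      using A \<phi>_hat unfolding elts_join_hat[OF A] by blast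
    show "elts ?v \<inter> \<phi> ` U \<subseteq> \<phi> ` \<Union>(b ` A)"
    proof
      fix w assume w: "w \<in> elts ?v \<inter> \<phi> ` U"
      then obtain p where p: "p \<in> A" "w \<in> hat p" unfolding elts_join_hat[OF A] by blast
      have "w \<notin> surplus p" using separated[of w] w unfolding separated_def by simp
      then show "w \<in> \<phi> ` \<Union>(b ` A)" using p unfolding hat_def by blast
    qed
  qed
  finally have "\<phi> ` elts x = \<phi> ` \<Union>(b ` A)" .
  moreover have "elts x \<subseteq> U" "\<Union>(b ` A) \<subseteq> U" using U_trans[OF xU] A by blast+
  moreover have "inj_on \<phi> U" using \<phi>_inj unfolding inj_on_def by blast
  ultimately have "elts x = \<Union>(b ` A)" by (simp add: inj_on_image_eq_iff)
  then have "x = join A" by (metis to_set_elts)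
  then show "join A \<in> b q" using x by simp
qed

lemma hat_outside: "q \<notin> W \<Longrightarrow> hat q = \<phi> ` b q"
  using surplus_outside unfolding hat_def by blast

lemma hat_infinite: "q \<in> K \<Longrightarrow> infinite (hat q)"
  by (rule infinite_super[OF order_trans[OF cycle_part_sub_surplus surplus_sub_hat] cycle_part_infinite])

end

section \<open>Satisfaction of the literals\<close>

locale disjoint_blocks =
  fixes P :: "'p set" and F :: "'p \<Rightarrow> 'a set"
  assumes F_nonempty: "q \<in> P \<Longrightarrow> F q \<noteq> {}"
    and F_disjoint: "p \<in> P \<Longrightarrow> q \<in> P \<Longrightarrow> x \<in> F p \<Longrightarrow> x \<in> F q \<Longrightarrow> p = q"
begin

lemma mem_UN_iff: "A \<subseteq> P \<Longrightarrow> q \<in> P \<Longrightarrow> x \<in> F q \<Longrightarrow> x \<in> \<Union>(F ` A) \<longleftrightarrow> q \<in> A"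
  using F_disjoint by blast

lemma UN_subset_iff:
  assumes "A \<subseteq> P" "B \<subseteq> P"
  shows "\<Union>(F ` A) \<subseteq> \<Union>(F ` B) \<longleftrightarrow> A \<subseteq> B"
proof
  assume sub: "\<Union>(F ` A) \<subseteq> \<Union>(F ` B)"
  show "A \<subseteq> B"
  proof
    fix q assume q: "q \<in> A"
    then obtain x where "x \<in> F q" using F_nonempty assms(1) by blast
    then show "q \<in> B" using mem_UN_iff[OF assms(2), of q x] sub q assms(1) by blast
  qed
qed blast

lemma UN_eq_iff: "A \<subseteq> P \<Longrightarrow> B \<subseteq> P \<Longrightarrow> \<Union>(F ` A) = \<Union>(F ` B) \<longleftrightarrow> A = B"
  unfolding set_eq_subset by (simp add: UN_subset_iff)

lemma UN_Int_eq:
  assumes "A \<subseteq> P" "B \<subseteq> P"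
  shows "\<Union>(F ` A) \<inter> \<Union>(F ` B) = \<Union>(F ` (A \<inter> B))"
proof
  show "\<Union>(F ` A) \<inter> \<Union>(F ` B) \<subseteq> \<Union>(F ` (A \<inter> B))"
  proof
    fix x assume x: "x \<in> \<Union>(F ` A) \<inter> \<Union>(F ` B)"
    then obtain p where p: "p \<in> A" "x \<in> F p" by blast
    then have "p \<in> B" using mem_UN_iff[OF assms(2), of p x] x assms(1) by blast
    then show "x \<in> \<Union>(F ` (A \<inter> B))" using p by blast
  qed
qed blast

lemma UN_Diff_eq:
  assumes "A \<subseteq> P" "B \<subseteq> P"
  shows "\<Union>(F ` A) - \<Union>(F ` B) = \<Union>(F ` (A - B))"
proof
  show "\<Union>(F ` A) - \<Union>(F ` B) \<subseteq> \<Union>(F ` (A - B))" by blast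
  show "\<Union>(F ` (A - B)) \<subseteq> \<Union>(F ` A) - \<Union>(F ` B)"
  proof
    fix x assume "x \<in> \<Union>(F ` (A - B))"
    then obtain p where p: "p \<in> A" "p \<notin> B" "x \<in> F p" by blast
    then have "x \<notin> \<Union>(F ` B)" using mem_UN_iff[OF assms(2), of p x] assms(1) by blast
    then show "x \<in> \<Union>(F ` A) - \<Union>(F ` B)" using p by blast
  qed
qed

end

context pumping
begin

interpretation old: disjoint_blocks P b
  by unfold_locales (fact b_nonempty, fact b_disjoint)

interpretation new: disjoint_blocks P hat
  by unfold_locales (fact hat_nonempty, fact hat_disjoint)

text \<open>
  A set below the blocks of \<open>A\<close> has as its node a subset of \<open>A\<close>. Arrows of the board turn such a set into
  an old one in the same block and conversely, so that the powerset relation between old blocks decides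
  the relation between new ones.
\<close>

lemma hat_powerset:
  assumes sub: "\<And>A'. A' \<subseteq> A \<Longrightarrow> A' \<in> Q" and B: "B \<subseteq> P"
    and pow: "\<Union>(b ` B) = {x. elts x \<subseteq> \<Union>(b ` A)}"
  shows "\<Union>(hat ` B) = {x. elts x \<subseteq> \<Union>(hat ` A)}"
proof (intro equalityI subsetI)
  have AP: "A \<subseteq> P" using Q_sub[OF sub] by blast
  fix v assume "v \<in> \<Union>(hat ` B)"
  then obtain q where q: "q \<in> B" "v \<in> hat q" by blast
  then obtain N where N: "N \<subseteq> P" "v \<in> pow_star (hat ` N)" "q \<in> induced_target P b N"
    using hat_trace B by blast
  then obtain x where x: "x \<in> pow_star (b ` N)" "x \<in> b q" unfolding induced_target_def by blast
  then have xA: "elts x \<subseteq> \<Union>(b ` A)" using pow q(1) by blast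
  have "N \<subseteq> A"
  proof
    fix p assume p: "p \<in> N"
    then obtain u where "u \<in> elts x" "u \<in> b p" using x(1) unfolding pow_star_def by blast
    then show "p \<in> A" using old.mem_UN_iff[OF AP, of p u] xA p N(1) by blast
  qed
  then show "v \<in> {x. elts x \<subseteq> \<Union>(hat ` A)}" using N(2) unfolding pow_star_def by blast
next
  fix v assume "v \<in> {x. elts x \<subseteq> \<Union>(hat ` A)}"
  then have vA: "elts v \<subseteq> \<Union>(hat ` A)" by simp
  define N where "N = {q \<in> A. elts v \<inter> hat q \<noteq> {}}"
  have NQ: "N \<in> Q" and NA: "N \<subseteq> A" using sub[of N] unfolding N_def by blast+
  have v: "v \<in> pow_star (hat ` N)" using vA unfolding pow_star_def N_def by blast
  then obtain q where q: "q \<in> P" "v \<in> hat q" using pow_star_hat_sub[OF NQ] by blast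
  then have "q \<in> induced_target P b N" using hat_target Q_sub[OF NQ] v by blast
  then obtain x where x: "x \<in> pow_star (b ` N)" "x \<in> b q" unfolding induced_target_def by blast
  then have "elts x \<subseteq> \<Union>(b ` A)" using NA unfolding pow_star_def by blast
  then have "x \<in> \<Union>(b ` B)" using pow by blast
  then have "q \<in> B" using old.mem_UN_iff[OF B q(1) x(2)] by simp
  then show "v \<in> \<Union>(hat ` B)" using q(2) by blast
qed

lemma UN_hat_outside: "A \<inter> W = {} \<Longrightarrow> \<Union>(hat ` A) = \<phi> ` \<Union>(b ` A)"
proof -
  assume "A \<inter> W = {}"
  then have "(\<Union>q\<in>A. hat q) = (\<Union>q\<in>A. \<phi> ` b q)"
    by (intro SUP_cong refl hat_outside) blast
  then show ?thesis by (simp only: image_UN)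
qed

text \<open>
  The surplus lies in \<open>W\<close>, so variables composed of blocks outside \<open>W\<close> receive the copy of
  their old value. In an enumeration the members are themselves unions of blocks, whose copies are the
  new values of the enumerated variables.
\<close>

lemma satisfies_pumped:
  fixes M :: "'x \<Rightarrow> 'v"
  assumes IP: "\<And>x. x \<in> lit_vars l \<Longrightarrow> I x \<subseteq> P"
    and MI: "\<And>x. x \<in> lit_vars l \<Longrightarrow> elts (M x) = \<Union>(b ` I x)"
    and sat: "(\<nexists>x. l = NotFinite x) \<Longrightarrow> satisfies M l"
    and green: "\<And>x. (\<exists>w ws. l = Enum x w ws) \<or> l = Finite x \<Longrightarrow> I x \<inter> W = {}"
    and pow: "\<And>u w A. l = Powerset u w \<Longrightarrow> A \<subseteq> I w \<Longrightarrow> A \<in> Q"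
    and cyc: "\<And>x. l = NotFinite x \<Longrightarrow> I x \<inter> K \<noteq> {}"
  shows "satisfies (\<lambda>x. to_set (\<Union>(hat ` I x))) l"
proof -
  let ?N = "\<lambda>x. to_set (\<Union>(hat ` I x))"
  have N: "elts (?N x) = \<Union>(hat ` I x)" if "x \<in> lit_vars l" for x
    by (rule elts_join_hat[OF IP[OF that]])
  have Mj: "M x = join (I x)" if "x \<in> lit_vars l" for x
    by (rule zfc_ext) (simp only: MI[OF that] elts_join[OF IP[OF that]])
  \<comment> \<open>Inclusions and equalities between values only depend on the sets of places.\<close>
  have sub: "elts (M v) \<subseteq> elts (M w) \<longleftrightarrow> I v \<subseteq> I w" "elts (?N v) \<subseteq> elts (?N w) \<longleftrightarrow> I v \<subseteq> I w"
    if "v \<in> lit_vars l" "w \<in> lit_vars l" for v w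
    unfolding MI[OF that(1)] MI[OF that(2)] N[OF that(1)] N[OF that(2)]
    by (rule old.UN_subset_iff[OF IP[OF that(1)] IP[OF that(2)]]
        new.UN_subset_iff[OF IP[OF that(1)] IP[OF that(2)]])+
  have eq: "M v = M w \<longleftrightarrow> I v = I w" "?N v = ?N w \<longleftrightarrow> I v = I w"
    if "v \<in> lit_vars l" "w \<in> lit_vars l" for v w
  proof -
    have "M v = M w \<longleftrightarrow> elts (M v) = elts (M w)" by (auto intro: zfc_ext)
    then show "M v = M w \<longleftrightarrow> I v = I w"
      unfolding MI[OF that(1)] MI[OF that(2)] old.UN_eq_iff[OF IP[OF that(1)] IP[OF that(2)]] .
    have "?N v = ?N w \<longleftrightarrow> elts (?N v) = elts (?N w)" by (auto intro: zfc_ext)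
    then show "?N v = ?N w \<longleftrightarrow> I v = I w"
      unfolding N[OF that(1)] N[OF that(2)] new.UN_eq_iff[OF IP[OF that(1)] IP[OF that(2)]] .
  qed
  have mem: "?N v \<in> elts (?N w) \<longleftrightarrow> M v \<in> elts (M w)"
    if "v \<in> lit_vars l" "w \<in> lit_vars l" for v w
    unfolding N[OF that(2)] MI[OF that(2)] Mj[OF that(1)]
    using join_hat_mem[OF IP[OF that(1)]] IP[OF that(2)] by (simp add: subset_iff)
  show ?thesis
  proof (cases l)
    case (Equal v w)
    then show ?thesis using sat eq by simp
  next
    case (NotEqual v w)
    then show ?thesis using sat eq by simp
  next
    case (Empty v)
    then have v: "v \<in> lit_vars l" by simp
    have "\<Union>(b ` I v) = {}" using sat Empty MI[OF v] by simp
    then have "I v = {}" using b_nonempty IP[OF v] by blast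
    then show ?thesis using Empty N[OF v] by simp
  next
    case (Union v u w)
    then have v: "v \<in> lit_vars l" "u \<in> lit_vars l" "w \<in> lit_vars l" by simp_all
    have "\<Union>(b ` I v) = \<Union>(b ` (I u \<union> I w))" using sat Union v by (simp add: MI)
    then have "I v = I u \<union> I w" using old.UN_eq_iff[of "I v" "I u \<union> I w"] IP v by simp
    then show ?thesis using Union N[OF v(1)] N[OF v(2)] N[OF v(3)] by simp
  next
    case (Inter v u w)
    then have v: "v \<in> lit_vars l" "u \<in> lit_vars l" "w \<in> lit_vars l" by simp_all
    note P = IP[OF v(1)] IP[OF v(2)] IP[OF v(3)]
    have "\<Union>(b ` I v) = \<Union>(b ` (I u \<inter> I w))"
      using sat Inter v unfolding old.UN_Int_eq[OF P(2,3), symmetric] by (simp add: MI)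
    then have "I v = I u \<inter> I w" using old.UN_eq_iff[of "I v" "I u \<inter> I w"] P by blast
    then show ?thesis
      using Inter N[OF v(1)] N[OF v(2)] N[OF v(3)] new.UN_Int_eq[OF P(2,3)] by simp
  next
    case (Diff v u w)
    then have v: "v \<in> lit_vars l" "u \<in> lit_vars l" "w \<in> lit_vars l" by simp_all
    note P = IP[OF v(1)] IP[OF v(2)] IP[OF v(3)]
    have "\<Union>(b ` I v) = \<Union>(b ` (I u - I w))"
      using sat Diff v unfolding old.UN_Diff_eq[OF P(2,3), symmetric] by (simp add: MI)
    then have "I v = I u - I w" using old.UN_eq_iff[of "I v" "I u - I w"] P by blast
    then show ?thesis
      using Diff N[OF v(1)] N[OF v(2)] N[OF v(3)] new.UN_Diff_eq[OF P(2,3)] by simp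
  next
    case (Subset v u)
    then show ?thesis using sat sub by simp
  next
    case (NotSubset v u)
    then show ?thesis using sat sub by simp
  next
    case (Member v w)
    then show ?thesis using sat mem by simp
  next
    case (NotMember v w)
    then show ?thesis using sat mem by simp
  next
    case (Powerset u w)
    then have v: "u \<in> lit_vars l" "w \<in> lit_vars l" by simp_all
    have "\<Union>(b ` I u) = {x. elts x \<subseteq> \<Union>(b ` I w)}"
      using sat Powerset MI[OF v(1)] MI[OF v(2)] by simp
    from hat_powerset[OF pow[OF Powerset] IP[OF v(1)] this] show ?thesis using Powerset N[OF v(1)] N[OF v(2)] by simp
  next
    case (Enum v w ws)
    then have v: "v \<in> lit_vars l" by simp
    have M: "elts (M v) = M ` set (w # ws)" using sat Enum by simp
    have "\<phi> (M u) = ?N u" if "u \<in> set (w # ws)" for u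
    proof -
      have u: "u \<in> lit_vars l" using Enum that by auto
      have "M u \<in> \<Union>(b ` I v)" using M that MI[OF v] by blast
      then have "M u \<in> U" using IP[OF v] by blast
      then show ?thesis using \<phi>_join[OF IP[OF u]] Mj[OF u] by simp
    qed
    then have "\<phi> ` M ` set (w # ws) = ?N ` set (w # ws)"
      unfolding image_image by (intro image_cong refl)
    moreover have "elts (?N v) = \<phi> ` elts (M v)"
      unfolding N[OF v] MI[OF v] by (rule UN_hat_outside) (use green Enum in blast)
    ultimately have "elts (?N v) = ?N ` set (w # ws)" using M by simp
    then show ?thesis unfolding Enum satisfies.simps .
  next
    case (Finite v)
    then have v: "v \<in> lit_vars l" by simp
    have "elts (?N v) = \<phi> ` elts (M v)"
      unfolding N[OF v] MI[OF v] by (rule UN_hat_outside) (use green Finite in blast)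
    then show ?thesis using sat Finite by simp
  next
    case (NotFinite v)
    then have v: "v \<in> lit_vars l" by simp
    obtain q where q: "q \<in> I v" "q \<in> K" using cyc[OF NotFinite] by blast
    then have "hat q \<subseteq> elts (?N v)" unfolding N[OF v] by blast
    then have "infinite (elts (?N v))" using hat_infinite[OF q(2)] finite_subset by metis
    then show ?thesis using NotFinite by simp
  qed
qed

end

section \<open>Unrolling a pumping cycle\<close>

text \<open>
  Reading the cycle periodically from \<open>q\<^sub>0\<close> on gives an infinite walk that visits each place again and
  again. Places occupy the odd positions and the period is even, so a walk by double steps starting
  at a place never lands on a node.
\<close>

lemma pumping_cycle_unroll:
  assumes cyc: "simple_pumping_cycle P G \<C>" and q0: "q\<^sub>0 \<in> path_places \<C>"
  obtains pl nd where "pl 0 = q\<^sub>0"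
    and "\<And>k::nat. pl k \<in> path_places \<C>" and "\<And>k. nd k \<in> path_nodes \<C>" and "\<And>k. nd k \<subseteq> P"
    and "\<And>k. pl k \<in> nd k" and "\<And>k. pl (Suc k) \<in> target G (nd k)"
    and "\<And>q. q \<in> path_places \<C> \<Longrightarrow> infinite {k. pl k = q}"
proof -
  from cyc obtain C\<^sub>0 vs where C: "\<C> = Node C\<^sub>0 # vs @ [Node C\<^sub>0]"
    and path: "board_path P G \<C>"
    unfolding simple_pumping_cycle_def by blast
  define ws where "ws = Node C\<^sub>0 # vs"
  define n where "n = length ws"
  define v where "v j = ws ! (j mod n)" for j
  have n: "n > 0" unfolding n_def ws_def by simp
  have Cws: "\<C> = ws @ [Node C\<^sub>0]" using C ws_def by simp
  have edge: "board_edge P G (v j) (v (Suc j))" for j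
  proof -
    have lt: "j mod n < n" using n by simp
    have "board_edge P G (\<C> ! (j mod n)) (\<C> ! Suc (j mod n))"
      using path lt unfolding board_path_def successively_conv_nth Cws n_def by simp
    moreover have "\<C> ! (j mod n) = v j" unfolding Cws v_def using lt n_def by (simp add: nth_append)
    moreover have "\<C> ! Suc (j mod n) = v (Suc j)"
    proof (cases "Suc (j mod n) = n")
      case True
      then have "Suc j mod n = 0" by (simp add: mod_Suc)
      then show ?thesis using True unfolding Cws v_def n_def by (simp add: nth_append ws_def)
    next
      case False
      then have "Suc (j mod n) < n" using lt by simp
      moreover have "Suc j mod n = Suc (j mod n)" using False by (simp add: mod_Suc)
      ultimately show ?thesis unfolding Cws v_def n_def by (simp add: nth_append)
    qed
    ultimately show ?thesis by simp
  qed
  have alt: "(\<exists>B. v (Suc j) = Node B) \<longleftrightarrow> (\<exists>q. v j = Place q)" for j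
    using edge[of j] by (auto elim: board_edge.cases)
  have node: "(\<exists>B. v j = Node B) \<longleftrightarrow> even j" for j
  proof (induction j)
    case 0
    show ?case using n unfolding v_def ws_def by simp
  next
    case (Suc j)
    have "(\<exists>q. v j = Place q) \<longleftrightarrow> \<not> (\<exists>B. v j = Node B)" by (cases "v j") auto
    then show ?case using Suc alt by simp
  qed
  have place: "(\<exists>q. v j = Place q) \<longleftrightarrow> odd j" for j
    using alt[of j] node[of "Suc j"] by simp
  have even_n: "even n"
    using node[of n] node[of 0] unfolding v_def by simp
  have pos: "\<exists>j<n. v j = Place q" if "q \<in> path_places \<C>" for q
  proof -
    have "Place q \<in> set ws" using that unfolding path_places_def Cws by auto
    then obtain j where "j < n" "ws ! j = Place q" unfolding n_def in_set_conv_nth by blast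
    then show ?thesis unfolding v_def by auto
  qed
  have v_set: "v j \<in> set \<C>" for j
    unfolding Cws v_def using n n_def by simp
  obtain j0 where j0: "j0 < n" "v j0 = Place q\<^sub>0" using pos[OF q0] by blast
  then have odd0: "odd j0" using place by blast
  define pl where "pl k = (SOME q. v (j0 + 2 * k) = Place q)" for k
  define nd where "nd k = (SOME B. v (Suc (j0 + 2 * k)) = Node B)" for k
  have pl: "v (j0 + 2 * k) = Place (pl k)" for k
    unfolding pl_def by (rule someI_ex) (use place odd0 in simp)
  have nd: "v (Suc (j0 + 2 * k)) = Node (nd k)" for k
    unfolding nd_def by (rule someI_ex) (use node odd0 in simp)
  have e1: "board_edge P G (Place (pl k)) (Node (nd k))" for k
    using edge[of "j0 + 2 * k"] pl nd by simp
  have e2: "board_edge P G (Node (nd k)) (Place (pl (Suc k)))" for k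
    using edge[of "Suc (j0 + 2 * k)"] pl[of "Suc k"] nd[of k] by simp
  show ?thesis
  proof
    show "pl 0 = q\<^sub>0" using pl[of 0] j0 by simp
    show "pl k \<in> path_places \<C>" for k
      using pl[of k] v_set unfolding path_places_def by (metis mem_Collect_eq)
    show "nd k \<in> path_nodes \<C>" for k
      using nd[of k] v_set unfolding path_nodes_def by (metis mem_Collect_eq)
    show "nd k \<subseteq> P" "pl k \<in> nd k" for k
      using e1[of k] by (auto elim: board_edge.cases)
    show "pl (Suc k) \<in> target G (nd k)" for k
      using e2[of k] by (auto elim: board_edge.cases)
    show "infinite {k. pl k = q}" if q: "q \<in> path_places \<C>" for q
      unfolding infinite_nat_iff_unbounded_le
    proof (intro allI)
      fix m :: nat
      obtain j where j: "j < n" "v j = Place q" using pos[OF q] by blast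
      \<comment> \<open>At least one full turn is added, to get past the starting position.\<close>
      define N where "N = j + (2 * m + 1) * n"
      have "2 * m * 1 \<le> 2 * m * n" using n by (intro mult_le_mono2) simp
      then have N: "j0 + 2 * m \<le> N" unfolding N_def using j0(1) by (simp add: algebra_simps)
      have "odd j" using j place by blast
      then have "even (N - j0)" unfolding N_def using even_n odd0 by simp
      then obtain k where k: "N - j0 = 2 * k" by blast
      then have Nk: "N = j0 + 2 * k" using N by simp
      have "v N = v j" unfolding v_def N_def by (simp only: mod_mult_self1)
      then have "pl k = q" using pl[of k] j(2) Nk by simp
      moreover have "m \<le> k" using N Nk by simp
      ultimately show "\<exists>k\<ge>m. k \<in> {k. pl k = q}" by blast
    qed
  qed
qed

section \<open>Entry stages in a formative process\<close>

text \<open>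
  The index is shifted so that, as for grand events, an element enters at \<open>\<nu>\<close> if it is new at \<open>\<nu> + 1\<close>.
\<close>

definition entry :: "'p set \<Rightarrow> (nat \<Rightarrow> 'p \<Rightarrow> 'v set) \<Rightarrow> 'v \<Rightarrow> nat" where
  "entry P s x = (LEAST \<nu>. x \<in> \<Union>(s (Suc \<nu>) ` P))"

lemma Union_stage_partition: "\<Union>(stage_partition P s \<nu>) = \<Union>(s \<nu> ` P)"
  unfolding stage_partition_def by blast

context
  fixes P :: "'p set" and L :: nat and s :: "nat \<Rightarrow> 'p \<Rightarrow> 'v::zfc_universe set"
  assumes fp: "formative_process P L s"
begin

lemma stage_mono: "\<mu> \<le> \<nu> \<Longrightarrow> \<nu> \<le> L \<Longrightarrow> q \<in> P \<Longrightarrow> s \<mu> q \<subseteq> s \<nu> q"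
proof (induction \<nu> rule: dec_induct)
  case (step \<nu>)
  moreover have "s \<nu> q \<subseteq> s (Suc \<nu>) q"
    using fp step unfolding formative_process_def by simp
  ultimately show ?case by simp
qed simp

lemma mem_stage_iff:
  assumes x: "x \<in> \<Union>(s L ` P)" and i: "i \<le> L"
  shows "x \<in> \<Union>(s i ` P) \<longleftrightarrow> entry P s x < i"
proof -
  have "s 0 q = {}" if "q \<in> P" for q using fp that unfolding formative_process_def by simp
  then have zero: "x \<notin> \<Union>(s 0 ` P)" by simp
  then have "L \<noteq> 0" using x by metis
  then have "x \<in> \<Union>(s (Suc (L - 1)) ` P)" using x by simp
  then have in_entry: "x \<in> \<Union>(s (Suc (entry P s x)) ` P)"
    unfolding entry_def by (rule LeastI)
  show ?thesis
  proof
    assume xi: "x \<in> \<Union>(s i ` P)"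
    then have "i \<noteq> 0" using zero by metis
    then obtain j where j: "i = Suc j" using not0_implies_Suc by blast
    then have "entry P s x \<le> j" unfolding entry_def using xi by (intro Least_le) simp
    then show "entry P s x < i" using j by simp
  next
    assume "entry P s x < i"
    then have "Suc (entry P s x) \<le> i" by simp
    then show "x \<in> \<Union>(s i ` P)" using in_entry stage_mono[OF _ i] by blast
  qed
qed

lemma entry_bound: "x \<in> \<Union>(s L ` P) \<Longrightarrow> entry P s x < L"
  using mem_stage_iff by blast

text \<open>
  Elements that enter at \<open>\<nu>\<close> are in \<open>pow_star \<Gamma>\<close>, hence consist of elements present at stage \<open>\<nu>\<close>.
\<close>

lemma elts_entry:
  assumes x: "x \<in> \<Union>(s L ` P)" and u: "u \<in> elts x"
  shows "u \<in> \<Union>(s L ` P)" and "entry P s u < entry P s x"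
proof -
  let ?\<nu> = "entry P s x"
  have L: "?\<nu> < L" using entry_bound[OF x] .
  have "x \<in> \<Union>(s (Suc ?\<nu>) ` P)" "x \<notin> \<Union>(s ?\<nu> ` P)"
    using mem_stage_iff[OF x, of "Suc ?\<nu>"] mem_stage_iff[OF x, of ?\<nu>] L by simp_all
  moreover obtain \<Gamma> where \<Gamma>: "\<Gamma> \<subseteq> stage_partition P s ?\<nu>"
    and "\<Union>(stage_partition P s (Suc ?\<nu>)) - \<Union>(stage_partition P s ?\<nu>) \<subseteq> pow_star \<Gamma>"
    using fp[unfolded formative_process_def, THEN conjunct2, THEN conjunct2, THEN conjunct2,
        rule_format, OF L] by (elim exE conjE)
  ultimately have "x \<in> pow_star \<Gamma>" unfolding Union_stage_partition by blast
  then have "elts x \<subseteq> \<Union>\<Gamma>" unfolding pow_star_def by blast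
  also have "\<dots> \<subseteq> \<Union>(s ?\<nu> ` P)"
    using \<Gamma> Union_stage_partition[of P s ?\<nu>] by blast
  finally have "elts x \<subseteq> \<Union>(s ?\<nu> ` P)" .
  then have u': "u \<in> \<Union>(s ?\<nu> ` P)" using u by blast
  then show uL: "u \<in> \<Union>(s L ` P)" using stage_mono[of ?\<nu> L] L by fastforce
  show "entry P s u < ?\<nu>" using mem_stage_iff[OF uL, of ?\<nu>] u' L by simp
qed

lemma GE_entry:
  assumes x: "x \<in> \<Union>(s L ` P)" "elts x = \<Union>(s L ` A)"
  shows "GE P L s A = entry P s x"
proof -
  have unique: "grand_event_at P L s A \<nu> \<longleftrightarrow> \<nu> = entry P s x" for \<nu>
  proof
    assume "grand_event_at P L s A \<nu>"
    then obtain y where \<nu>: "\<nu> < L" and y: "y \<in> \<Union>(s (Suc \<nu>) ` P)" "y \<notin> \<Union>(s \<nu> ` P)"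
      "elts y = \<Union>(s L ` A)"
      unfolding grand_event_at_def by blast
    then have "y = x" using x(2) zfc_ext by metis
    then show "\<nu> = entry P s x"
      using mem_stage_iff[OF x(1), of "Suc \<nu>"] mem_stage_iff[OF x(1), of \<nu>] \<nu> y by simp
  next
    assume \<nu>: "\<nu> = entry P s x"
    have "\<nu> < L" using entry_bound[OF x(1)] \<nu> by simp
    then have "x \<in> \<Union>(s (Suc \<nu>) ` P) - \<Union>(s \<nu> ` P)"
      using mem_stage_iff[OF x(1), of "Suc \<nu>"] mem_stage_iff[OF x(1), of \<nu>] \<nu> by simp
    then show "grand_event_at P L s A \<nu>"
      unfolding grand_event_at_def using \<open>\<nu> < L\<close> x(2) by blast
  qed
  show ?thesis unfolding GE_def unique by simp
qed

end


section \<open>The canonical board\<close>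

lemma formula_vars_finite: "finite \<Phi> \<Longrightarrow> finite (formula_vars \<Phi>)"
proof -
  have "finite (lit_vars l)" for l :: "'x literal" by (cases l) simp_all
  then show "finite \<Phi> \<Longrightarrow> finite (formula_vars \<Phi>)" unfolding formula_vars_def by blast
qed

lemma Union_model_partition: "\<Union>(model_partition M \<Phi>) = (\<Union>x\<in>formula_vars \<Phi>. elts (M x))"
  using is_venn_partition_venn_partition[of "(\<lambda>v. elts (M v)) ` formula_vars \<Phi>"]
  unfolding is_venn_partition_def compatible_partition_def partition_on_def model_partition_def
  by simp

lemma var_blocks_red:
  assumes "(\<exists>w ws. Enum x w ws \<in> \<Phi>) \<or> Finite x \<in> \<Phi>"
  shows "var_blocks M \<Phi> x \<subseteq> red (canonical_board M \<Phi>)"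
  using assms unfolding canonical_board_def by auto

lemma var_blocks_pow_node:
  assumes "Powerset u w \<in> \<Phi>" "B \<subseteq> var_blocks M \<Phi> w"
  shows "B \<in> pow_nodes (canonical_board M \<Phi>)"
  using assms unfolding canonical_board_def by auto

text \<open>
  The subsets of the blocks of powerset arguments form one of the collections that are intersected.
\<close>

lemma pow_node_cases:
  assumes "B \<in> pow_nodes (canonical_board M \<Phi>)"
  obtains u w where "Powerset u w \<in> \<Phi>" "B \<subseteq> var_blocks M \<Phi> w"
proof -
  let ?Q = "{B. \<exists>u w. Powerset u w \<in> \<Phi> \<and> B \<subseteq> var_blocks M \<Phi> w}"
  have "pow_nodes (canonical_board M \<Phi>) \<subseteq> ?Q"
    unfolding canonical_board_def board.simps
    by (rule Inter_lower) auto
  then show thesis using assms that by blast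
qed

theorem theorem39:
  fixes \<Phi> :: "'x literal set"
    and M :: "'x \<Rightarrow> 'v::zfc_universe"
    and P :: "'p set"
    and s :: "nat \<Rightarrow> 'p \<Rightarrow> 'v set"
    and L :: nat
    and G :: "'p board"
    and q\<^sub>0 :: 'p
    and i\<^sub>0 :: nat
    and \<C> :: "'p vertex list"
  assumes "finite \<Phi>"
    and "\<forall>x\<in>formula_vars \<Phi>. finite (elts (M x))"
    and "transitive_partition (model_partition M \<Phi>)"
    and "\<forall>l\<in>\<Phi>. (\<nexists>x. l = NotFinite x) \<longrightarrow> satisfies M l"
    and "colored_process P L s G"
    and "associated_with_canonical M \<Phi> P L s G"
    and "simple_pumping_event P L s G q\<^sub>0 i\<^sub>0 \<C>"
    and "\<exists>W. closed_places P L s G W \<and> path_places \<C> \<subseteq> W"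
    and "\<forall>x. NotFinite x \<in> \<Phi> \<longrightarrow> var_blocks M \<Phi> x \<inter> s L ` path_places \<C> \<noteq> {}"
  shows "\<exists>M' :: 'x \<Rightarrow> 'v. is_model M' \<Phi>"
proof -
  define b where "b = s L"
  define e where "e = entry P s"
  define Q where "Q = pow_nodes G"
  define K where "K = path_places \<C>"
  have fp: "formative_process P L s" and board: "colored_board P G"
    and target: "\<And>A. A \<subseteq> P \<Longrightarrow> target G A = induced_target P b A"
    using assms(5) unfolding colored_process_def b_def by simp_all
  have final: "stage_partition P s L = model_partition M \<Phi>"
    and bij: "bij_betw b P (model_partition M \<Phi>)"
    and red: "b ` red G = red (canonical_board M \<Phi>)"
    and pow: "(\<lambda>A. b ` A) ` Q = pow_nodes (canonical_board M \<Phi>)"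
    using assms(6) unfolding associated_with_canonical_def board_identified_def b_def Q_def by simp_all
  have finP: "finite P" and redP: "red G \<subseteq> P" and QP: "\<And>A. A \<in> Q \<Longrightarrow> A \<subseteq> P"
    using board unfolding colored_board_def Q_def by auto
  have b_ne: "b q \<noteq> {}" if "q \<in> P" for q
    using fp that unfolding formative_process_def b_def by simp
  have b_disj: "p = q" if "p \<in> P" "q \<in> P" "x \<in> b p" "x \<in> b q" for p q x
  proof (rule ccontr)
    assume "p \<noteq> q"
    then have "s L q \<inter> s L p = {}"
      using fp[unfolded formative_process_def, THEN conjunct1] that by simp
    then show False using that unfolding b_def by blast
  qed
  have b_inj: "p = q" if "p \<in> P" "q \<in> P" "b p = b q" for p q
    using b_disj b_ne that by blast
  have U: "\<Union>(b ` P) = (\<Union>x\<in>formula_vars \<Phi>. elts (M x))"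
    unfolding b_def Union_stage_partition[of P s L, symmetric] final
    by (rule Union_model_partition)
  have "finite (\<Union>(b ` P))"
    unfolding U using assms(1,2) formula_vars_finite by blast
  then have b_small: "small (b q)" if "q \<in> P" for q
    using that by (intro small_finite) (rule finite_subset[OF UN_upper])
  define I where "I x = {q \<in> P. b q \<subseteq> elts (M x)}" for x
  have IP: "I x \<subseteq> P" for x unfolding I_def by blast
  have bI: "b ` I x = var_blocks M \<Phi> x" if "x \<in> formula_vars \<Phi>" for x
    unfolding var_blocks_eq(1)[OF that] I_def bij_betw_imp_surj_on[OF bij, symmetric] by blast
  have MI: "elts (M x) = \<Union>(b ` I x)" if "x \<in> formula_vars \<Phi>" for x
    unfolding bI[OF that] by (rule var_blocks_eq(2)[OF that])
  have mem_I: "q \<in> I x" if "q \<in> P" "b q \<in> var_blocks M \<Phi> x" "x \<in> formula_vars \<Phi>" for q x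
    using that(2) b_inj that(1) IP unfolding bI[OF that(3), symmetric] by blast
  have vars: "x \<in> formula_vars \<Phi>" if "l \<in> \<Phi>" "x \<in> lit_vars l" for l x
    using that unfolding formula_vars_def by blast
  have subset_inj: "A = B" if "A \<subseteq> P" "B \<subseteq> P" "b ` A = b ` B" for A B
    using that by (metis bij bij_betw_def inj_on_image_eq_iff)
  have Q_mem: "A \<in> Q" if "Powerset u w \<in> \<Phi>" "A \<subseteq> I w" for u w A
  proof -
    have "w \<in> formula_vars \<Phi>" using vars[OF that(1)] by simp
    then have "b ` A \<subseteq> var_blocks M \<Phi> w" using bI that(2) by blast
    then have "b ` A \<in> (\<lambda>A. b ` A) ` Q"
      unfolding pow by (rule var_blocks_pow_node[OF that(1)])
    then obtain A' where A': "A' \<in> Q" "b ` A = b ` A'" by blast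
    have "A = A'" using that(2) IP[of w] QP[OF A'(1)] A'(2) by (intro subset_inj) auto
    then show ?thesis using A'(1) by simp
  qed
  have Q_pow: "pow_star (b ` A) \<subseteq> \<Union>(b ` P)" if "A \<in> Q" for A
  proof -
    have "b ` A \<in> pow_nodes (canonical_board M \<Phi>)" using that pow by blast
    then obtain u w where uw: "Powerset u w \<in> \<Phi>" "b ` A \<subseteq> var_blocks M \<Phi> w"
      by (rule pow_node_cases)
    have v: "u \<in> formula_vars \<Phi>" "w \<in> formula_vars \<Phi>" using vars[OF uw(1)] by simp_all
    have "\<Union>(b ` A) \<subseteq> elts (M w)" using uw(2) var_blocks_eq(2)[OF v(2)] by blast
    then have "pow_star (b ` A) \<subseteq> {x. elts x \<subseteq> elts (M w)}" unfolding pow_star_def by blast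
    also have "\<dots> = elts (M u)" using assms(4) uw(1) by fastforce
    finally show ?thesis using v(1) unfolding U by blast
  qed
  have join: "elts (to_set (\<Union>(b ` A))) = \<Union>(b ` A)" if "A \<subseteq> P" for A
    using that b_small finP by (intro elts_to_set small_UN_finite) (auto intro: finite_subset)
  have GE: "GE P L s A = e (to_set (\<Union>(b ` A)))"
    if "A \<subseteq> P" "to_set (\<Union>(b ` A)) \<in> \<Union>(b ` P)" for A
    using GE_entry[OF fp, folded b_def e_def, OF that(2) join[OF that(1)]] .
  have join_Q: "to_set (\<Union>(b ` A)) \<in> \<Union>(b ` P)" if "A \<in> Q" for A
  proof -
    have "to_set (\<Union>(b ` A)) \<in> pow_star (b ` A)"
      unfolding pow_star_def mem_Collect_eq join[OF QP[OF that]] using b_ne QP[OF that] by blast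
    then show ?thesis using Q_pow[OF that] by blast
  qed
  obtain W where closed: "closed_places P L s G W" and KW: "K \<subseteq> W"
    using assms(8) unfolding K_def by blast
  have W: "W \<subseteq> P" "W \<inter> red G = {}" using closed unfolding closed_places_def by blast+
  have "\<exists>g\<in>W. local_trash P L s G g A" if "A \<in> Q" "A \<inter> W \<noteq> {}" for A
    using closed that unfolding closed_places_def Q_def by blast
  then obtain g where g: "\<And>A. A \<in> Q \<Longrightarrow> A \<inter> W \<noteq> {} \<Longrightarrow> g A \<in> W \<and> local_trash P L s G (g A) A"
    by metis
  from assms(7) have i0: "i\<^sub>0 \<le> L" and cyc: "simple_pumping_cycle P G \<C>"
    and q0: "q\<^sub>0 \<in> path_places \<C>" and z_ex: "s i\<^sub>0 q\<^sub>0 - \<Union>(elts ` \<Union>(s i\<^sub>0 ` P)) \<noteq> {}"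
    and ge: "i\<^sub>0 \<le> GE_coll P L s (nodes_meeting P K)"
    and nodes: "\<And>B. B \<in> path_nodes \<C> \<Longrightarrow> {} \<notin> s i\<^sub>0 ` B"
    unfolding simple_pumping_event_def K_def by blast+
  obtain pl nd where pl0: "pl 0 = q\<^sub>0" and plK: "\<And>k. pl k \<in> path_places \<C>"
    and ndC: "\<And>k. nd k \<in> path_nodes \<C>" and ndP: "\<And>k. nd k \<subseteq> P"
    and pl_nd: "\<And>k. pl k \<in> nd k" and pl_t: "\<And>k. pl (Suc k) \<in> target G (nd k)"
    and pl_inf: "\<And>q. q \<in> path_places \<C> \<Longrightarrow> infinite {k. pl k = q}"
    by (rule pumping_cycle_unroll[OF cyc q0]) (rule that)
  note mem_stage = mem_stage_iff[OF fp _ i0, folded b_def e_def]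
  have early: "x \<in> b q \<and> e x < i\<^sub>0" if "x \<in> s i\<^sub>0 q" "q \<in> P" for x q
  proof -
    have "x \<in> b q" using stage_mono[OF fp i0 order_refl that(2)] that(1) unfolding b_def by blast
    moreover from this have "x \<in> \<Union>(b ` P)" using that(2) by blast
    ultimately show ?thesis using mem_stage[of x] that by blast
  qed
  obtain z where z: "z \<in> s i\<^sub>0 q\<^sub>0" "\<And>x. x \<in> \<Union>(s i\<^sub>0 ` P) \<Longrightarrow> z \<notin> elts x"
    using z_ex by blast
  \<comment> \<open>At stage \<open>i\<^sub>0\<close> all blocks of nodes on the cycle are nonempty.\<close>
  define rep where "rep p = (SOME r. r \<in> s i\<^sub>0 p)" for p
  have rep: "rep p \<in> s i\<^sub>0 p" if "p \<in> nd k" for p k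
  proof -
    have "s i\<^sub>0 p \<noteq> {}" using nodes[OF ndC[of k]] that by (metis imageI)
    then show ?thesis unfolding rep_def by (rule some_in_eq[THEN iffD2])
  qed
  have cycle_time: "i\<^sub>0 \<le> e (to_set (\<Union>(b ` A)))"
    if "A \<subseteq> P" "A \<inter> K \<noteq> {}" "to_set (\<Union>(b ` A)) \<in> \<Union>(b ` P)" for A
  proof -
    have "finite (nodes_meeting P K)"
      by (rule finite_subset[of _ "Pow P"]) (use finP in \<open>auto simp: nodes_meeting_def\<close>)
    then have "GE_coll P L s (nodes_meeting P K) \<le> GE P L s A"
      unfolding GE_coll_def using that by (intro Min_le) (auto simp: nodes_meeting_def)
    then show ?thesis using ge GE[OF that(1,3)] by simp
  qed
  interpret pumping P b e i\<^sub>0 L Q W K g pl nd z rep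
  proof
    show "finite P" by (fact finP)
    show "small (b q)" "b q \<noteq> {}" if "q \<in> P" for q using b_small b_ne that by blast+
    show "p = q" if "p \<in> P" "q \<in> P" "x \<in> b p" "x \<in> b q" for p q x using b_disj that by blast
    show "u \<in> \<Union>(b ` P)" "e u < e x" if "x \<in> \<Union>(b ` P)" "u \<in> elts x" for x u
      by (fact elts_entry[OF fp, folded b_def e_def, OF that])+
    show "e x < L" if "x \<in> \<Union>(b ` P)" for x
      by (fact entry_bound[OF fp, folded b_def e_def, OF that])
    show "A \<subseteq> P" "pow_star (b ` A) \<subseteq> \<Union>(b ` P)" if "A \<in> Q" for A
      using QP Q_pow that by blast+
    show "W \<subseteq> P" "K \<subseteq> W" by (fact W(1), fact KW)
    fix A assume A: "A \<in> Q" "A \<inter> W \<noteq> {}"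
    show "g A \<in> W" using g[OF A] by simp
    have "g A \<in> target G A" using g[OF A] unfolding local_trash_def by blast
    then show "g A \<in> induced_target P b A" using target QP A(1) by simp
    show "e (to_set (\<Union>(b ` A))) < e (to_set (\<Union>(b ` B)))"
      if "B \<subseteq> P" "g A \<in> B" "to_set (\<Union>(b ` B)) \<in> \<Union>(b ` P)" for B
    proof -
      have "GE P L s A < GE P L s B" using g[OF A] that unfolding local_trash_def by blast
      then show ?thesis using GE[OF QP[OF A(1)] join_Q[OF A(1)]] GE[OF that(1,3)] by simp
    qed
  next
    show "i\<^sub>0 \<le> e (to_set (\<Union>(b ` A)))"
      if "A \<subseteq> P" "A \<inter> K \<noteq> {}" "to_set (\<Union>(b ` A)) \<in> \<Union>(b ` P)" for A
      by (rule cycle_time[OF that])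
    show "pl k \<in> K" "nd k \<subseteq> P" "pl k \<in> nd k" for k
      unfolding K_def by (fact plK, fact ndP, fact pl_nd)
    show "pl (Suc k) \<in> induced_target P b (nd k)" for k
      using pl_t[of k] target[OF ndP[of k]] by simp
    show "infinite {k. pl k = q}" if "q \<in> K" for q using pl_inf that unfolding K_def by blast
    have "q\<^sub>0 \<in> P" using pl0 ndP[of 0] pl_nd[of 0] by blast
    then show "z \<in> b (pl 0)" "e z < i\<^sub>0" using early[OF z(1)] pl0 by simp_all
    show "z \<notin> elts x" if "x \<in> \<Union>(b ` P)" "e x < i\<^sub>0" for x
      using mem_stage[OF that(1)] z(2)[of x] that(2) by blast
    show "rep p \<in> b p" "e (rep p) < i\<^sub>0" if "p \<in> nd k" for p k
      using early[OF rep[OF that]] ndP that by blast+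
  qed
  have green: "I x \<inter> W = {}" if "(\<exists>w ws. Enum x w ws \<in> \<Phi>) \<or> Finite x \<in> \<Phi>" for x
  proof -
    have "x \<in> formula_vars \<Phi>" using that vars by fastforce
    then have "b ` I x \<subseteq> b ` red G" using bI var_blocks_red[OF that, of M] red by simp
    then have "I x \<subseteq> red G" using b_inj IP[of x] redP by blast
    then show ?thesis using W(2) by blast
  qed
  have "satisfies (\<lambda>x. to_set (\<Union>(hat ` I x))) l" if l: "l \<in> \<Phi>" for l
  proof (rule satisfies_pumped)
    show "elts (M x) = \<Union>(b ` I x)" if "x \<in> lit_vars l" for x using MI vars[OF l that] .
    show "satisfies M l" if "\<nexists>x. l = NotFinite x" using assms(4) l that by blast
    show "I x \<inter> W = {}" if "(\<exists>w ws. l = Enum x w ws) \<or> l = Finite x" for x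
      using green[of x] l that by blast
    show "A \<in> Q" if "l = Powerset u w" "A \<subseteq> I w" for u w A
      using Q_mem that l by blast
    show "I x \<inter> K \<noteq> {}" if nf: "l = NotFinite x" for x
    proof -
      have x: "x \<in> formula_vars \<Phi>" using vars[OF l] nf by simp
      obtain q where "q \<in> K" "b q \<in> var_blocks M \<Phi> x"
        using assms(9) l nf unfolding K_def b_def by blast
      then show ?thesis using mem_I[OF _ _ x] KW W(1) by blast
    qed
  qed (rule IP)
  then show ?thesis unfolding is_model_def by blast
qed

end
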